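(* Let $R$ be a two-sided Noetherian domain (not necessarily commutative) and let $M$ be a finitely generated $R$-module. If $M$ is projective up to grade $2$, then the torsion-free factor $M/\operatorname{t}(M)$ of $M$ is projective.
   Context: Rings are unital and not necessarily commutative; "domain" does not imply commutativity; modules are left $R$-modules (the statement holds equally for right modules). Since $R$ is a two-sided Noetherian domain, it satisfies the Ore condition, so the set $\operatorname{t}(M)$ of torsion elements of $M$ (elements annihilated by some nonzero element of $R$) is an $R$-submodule. Grade: for an integer $c$, an $R$-module $T$ has grade at least $c$ if $\operatorname{Ext}^i_R(T,R)=0$ for all $0\le i<c$. Projective up to grade $c$: an $R$-module $M$ is projective up to grade $c$ if there exist a projective $R$-module $P$ and an epimorphism $\pi: P\to M$ such that, with $A:=\ker\pi$, there is a submodule $B\le P$ with $A\cap B=0$ and such that $P/(A+B)$ has grade at least $c$. If $M$ is finitely generated, then $P$ is required to be finitely generated. *)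

theory Defs
  imports "HOL-Algebra.Module" "HOL-Algebra.AbelCoset" "HOL-Algebra.Elementary_Groups"
begin

section \<open>Left modules over a not necessarily commutative ring\<close>

text \<open>The library locale \<^locale>\<open>module\<close> requires a commutative ring of scalars. Its record type
  and the locale \<^locale>\<open>submodule\<close> (which makes no such demand) are reused. The fields
  \<^const>\<open>mult\<close> and \<^const>\<open>one\<close> of a module record carry no meaning.\<close>

locale left_module = R?: ring R + M?: abelian_group M
  for R :: "('r, 'x) ring_scheme" (structure) and M :: "('r, 'a, 'y) module_scheme" (structure) +
  assumes smult_closed [simp, intro]:
      "\<lbrakk>a \<in> carrier R; x \<in> carrier M\<rbrakk> \<Longrightarrow> a \<odot>\<^bsub>M\<^esub> x \<in> carrier M"
    and smult_l_distr:
      "\<lbrakk>a \<in> carrier R; b \<in> carrier R; x \<in> carrier M\<rbrakk> \<Longrightarrow>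
        (a \<oplus>\<^bsub>R\<^esub> b) \<odot>\<^bsub>M\<^esub> x = a \<odot>\<^bsub>M\<^esub> x \<oplus>\<^bsub>M\<^esub> b \<odot>\<^bsub>M\<^esub> x"
    and smult_r_distr:
      "\<lbrakk>a \<in> carrier R; x \<in> carrier M; y \<in> carrier M\<rbrakk> \<Longrightarrow>
        a \<odot>\<^bsub>M\<^esub> (x \<oplus>\<^bsub>M\<^esub> y) = a \<odot>\<^bsub>M\<^esub> x \<oplus>\<^bsub>M\<^esub> a \<odot>\<^bsub>M\<^esub> y"
    and smult_assoc1:
      "\<lbrakk>a \<in> carrier R; b \<in> carrier R; x \<in> carrier M\<rbrakk> \<Longrightarrow>
        (a \<otimes>\<^bsub>R\<^esub> b) \<odot>\<^bsub>M\<^esub> x = a \<odot>\<^bsub>M\<^esub> (b \<odot>\<^bsub>M\<^esub> x)"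
    and smult_one [simp]:
      "x \<in> carrier M \<Longrightarrow> \<one>\<^bsub>R\<^esub> \<odot>\<^bsub>M\<^esub> x = x"

definition mod_hom ::
    "('r, 'x) ring_scheme \<Rightarrow> ('r, 'a, 'y) module_scheme \<Rightarrow> ('r, 'b, 'z) module_scheme \<Rightarrow> ('a \<Rightarrow> 'b) set"
  where "mod_hom R M N = {f \<in> hom (add_monoid M) (add_monoid N).
    \<forall>r\<in>carrier R. \<forall>x\<in>carrier M. f (r \<odot>\<^bsub>M\<^esub> x) = r \<odot>\<^bsub>N\<^esub> f x}"

definition regular_module :: "('r, 'x) ring_scheme \<Rightarrow> ('r, 'r) module"
  where "regular_module R = \<lparr>carrier = carrier R, mult = mult R, one = \<one>\<^bsub>R\<^esub>,
    zero = \<zero>\<^bsub>R\<^esub>, add = add R, smult = mult R\<rparr>"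

definition mod_span :: "('r, 'x) ring_scheme \<Rightarrow> ('r, 'a, 'y) module_scheme \<Rightarrow> 'a set \<Rightarrow> 'a set"
  where "mod_span R M S = \<Inter>{N. submodule N R M \<and> S \<subseteq> N}"

definition fin_gen :: "('r, 'x) ring_scheme \<Rightarrow> ('r, 'a, 'y) module_scheme \<Rightarrow> bool"
  where "fin_gen R M \<longleftrightarrow> (\<exists>S. finite S \<and> S \<subseteq> carrier M \<and> mod_span R M S = carrier M)"

definition quot_module ::
    "('r, 'x) ring_scheme \<Rightarrow> ('r, 'a, 'y) module_scheme \<Rightarrow> 'a set \<Rightarrow> ('r, 'a set) module"
  where "quot_module R M H = \<lparr>carrier = a_rcosets\<^bsub>M\<^esub> H, mult = undefined, one = undefined,
    zero = H, add = set_add M, smult = (\<lambda>r X. \<Union>x\<in>X. H +>\<^bsub>M\<^esub> (r \<odot>\<^bsub>M\<^esub> x))\<rparr>"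

definition torsion :: "('r, 'x) ring_scheme \<Rightarrow> ('r, 'a, 'y) module_scheme \<Rightarrow> 'a set"
  where "torsion R M = {x \<in> carrier M. \<exists>r\<in>carrier R - {\<zero>\<^bsub>R\<^esub>}. r \<odot>\<^bsub>M\<^esub> x = \<zero>\<^bsub>M\<^esub>}"

section \<open>Two-sided Noetherian domains\<close>

text \<open>The library locales \<^locale>\<open>domain\<close> and \<open>noetherian_ring\<close> are about commutative
  rings and about two-sided ideals, respectively, hence do not apply here.\<close>

definition nc_domain :: "('r, 'x) ring_scheme \<Rightarrow> bool"
  where "nc_domain R \<longleftrightarrow> ring R \<and> \<one>\<^bsub>R\<^esub> \<noteq> \<zero>\<^bsub>R\<^esub> \<and>
    (\<forall>a\<in>carrier R. \<forall>b\<in>carrier R. a \<otimes>\<^bsub>R\<^esub> b = \<zero>\<^bsub>R\<^esub> \<longrightarrow> a = \<zero>\<^bsub>R\<^esub> \<or> b = \<zero>\<^bsub>R\<^esub>)"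

definition opposite_ring :: "('r, 'x) ring_scheme \<Rightarrow> ('r, 'x) ring_scheme"
  where "opposite_ring R = R\<lparr>mult := (\<lambda>a b. b \<otimes>\<^bsub>R\<^esub> a)\<rparr>"

definition left_noetherian :: "('r, 'x) ring_scheme \<Rightarrow> bool"
  where "left_noetherian R \<longleftrightarrow> ring R \<and>
    (\<forall>I. submodule I R (regular_module R) \<longrightarrow>
      (\<exists>S. finite S \<and> S \<subseteq> I \<and> mod_span R (regular_module R) S = I))"

definition two_sided_noetherian :: "('r, 'x) ring_scheme \<Rightarrow> bool"
  where "two_sided_noetherian R \<longleftrightarrow> left_noetherian R \<and> left_noetherian (opposite_ring R)"

section \<open>Projective modules\<close>

text \<open>The lifting property quantifies over all modules, but a definition cannot quantify over
  types. The test modules are therefore taken with carriers in the following type, which contains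
  a copy of \<open>'a\<close> and is closed under formal linear combinations over \<open>'r\<close>, so that it
  contains all the free modules that matter. By \<open>projective_lift\<close> below, the lifting property then
  holds for test modules over arbitrary types.\<close>

datatype ('r, 'a) univ = Gen 'a | Comb "('r \<times> ('r, 'a) univ) list"

definition projective :: "('r, 'x) ring_scheme \<Rightarrow> ('r, 'a, 'y) module_scheme \<Rightarrow> bool"
  where "projective R P \<longleftrightarrow> left_module R P \<and>
    (\<forall>(N :: ('r, ('r, 'a) univ) module) (L :: ('r, ('r, 'a) univ) module).
      left_module R N \<longrightarrow> left_module R L \<longrightarrow>
      (\<forall>g\<in>mod_hom R N L. \<forall>f\<in>mod_hom R P L. g ` carrier N = carrier L \<longrightarrow>
        (\<exists>h\<in>mod_hom R P N. \<forall>x\<in>carrier P. g (h x) = f x)))"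

section \<open>Ext and grade\<close>

definition proj_resolution ::
    "('r, 'x) ring_scheme \<Rightarrow> ('r, 't, 'y) module_scheme \<Rightarrow> (nat \<Rightarrow> ('r, 'a) module) \<Rightarrow>
      (nat \<Rightarrow> 'a \<Rightarrow> 'a) \<Rightarrow> ('a \<Rightarrow> 't) \<Rightarrow> bool"
  where "proj_resolution R T P d \<epsilon> \<longleftrightarrow>
    (\<forall>n. projective R (P n)) \<and>
    \<epsilon> \<in> mod_hom R (P 0) T \<and> \<epsilon> ` carrier (P 0) = carrier T \<and>
    (\<forall>n. d n \<in> mod_hom R (P (Suc n)) (P n)) \<and>
    d 0 ` carrier (P 1) = a_kernel (P 0) T \<epsilon> \<and>
    (\<forall>n. d (Suc n) ` carrier (P (Suc (Suc n))) = a_kernel (P (Suc n)) (P n) (d n))"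

text \<open>Homomorphisms are made extensional outside the carrier, so that equality of elements of the
  Hom group is equality of homomorphisms.\<close>

definition Hom_group ::
    "('r, 'x) ring_scheme \<Rightarrow> ('r, 'a, 'y) module_scheme \<Rightarrow> ('r, 'b, 'z) module_scheme \<Rightarrow> ('a \<Rightarrow> 'b) monoid"
  where "Hom_group R M N = \<lparr>carrier = mod_hom R M N \<inter> extensional (carrier M),
    mult = (\<lambda>f g. \<lambda>x\<in>carrier M. f x \<oplus>\<^bsub>N\<^esub> g x), one = (\<lambda>x\<in>carrier M. \<zero>\<^bsub>N\<^esub>)\<rparr>"

definition cocycles ::
    "('r, 'x) ring_scheme \<Rightarrow> (nat \<Rightarrow> ('r, 'a) module) \<Rightarrow> (nat \<Rightarrow> 'a \<Rightarrow> 'a) \<Rightarrow>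
      ('r, 'b, 'z) module_scheme \<Rightarrow> nat \<Rightarrow> ('a \<Rightarrow> 'b) set"
  where "cocycles R P d N i = {f \<in> carrier (Hom_group R (P i) N).
    \<forall>x\<in>carrier (P (Suc i)). f (d i x) = \<zero>\<^bsub>N\<^esub>}"

fun coboundaries ::
    "('r, 'x) ring_scheme \<Rightarrow> (nat \<Rightarrow> ('r, 'a) module) \<Rightarrow> (nat \<Rightarrow> 'a \<Rightarrow> 'a) \<Rightarrow>
      ('r, 'b, 'z) module_scheme \<Rightarrow> nat \<Rightarrow> ('a \<Rightarrow> 'b) set"
  where
    "coboundaries R P d N 0 = {\<one>\<^bsub>Hom_group R (P 0) N\<^esub>}"
  | "coboundaries R P d N (Suc i) =
      (\<lambda>g. compose (carrier (P (Suc i))) g (d i)) ` carrier (Hom_group R (P i) N)"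

definition Hom_cohomology ::
    "('r, 'x) ring_scheme \<Rightarrow> (nat \<Rightarrow> ('r, 'a) module) \<Rightarrow> (nat \<Rightarrow> 'a \<Rightarrow> 'a) \<Rightarrow>
      ('r, 'b, 'z) module_scheme \<Rightarrow> nat \<Rightarrow> ('a \<Rightarrow> 'b) set monoid"
  where "Hom_cohomology R P d N i =
    (Hom_group R (P i) N)\<lparr>carrier := cocycles R P d N i\<rparr> Mod coboundaries R P d N i"

text \<open>\<open>Ext R i T N\<close> is the \<open>i\<close>-th cohomology group of \<open>Hom(P, N)\<close> for a chosen projective resolution
  \<open>P\<close> of \<open>T\<close>; a resolution with carriers in the type below exists by
  \<open>ex_proj_resolution\<close>, and another choice yields an isomorphic group.\<close>

definition chosen_resolution ::
    "('r, 'x) ring_scheme \<Rightarrow> ('r, 't, 'y) module_scheme \<Rightarrow>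
      (nat \<Rightarrow> ('r, ('r, 't) univ) module) \<times> (nat \<Rightarrow> ('r, 't) univ \<Rightarrow> ('r, 't) univ)"
  where "chosen_resolution R T = (SOME (P, d). \<exists>\<epsilon>. proj_resolution R T P d \<epsilon>)"

definition Ext ::
    "('r, 'x) ring_scheme \<Rightarrow> nat \<Rightarrow> ('r, 't, 'y) module_scheme \<Rightarrow> ('r, 'b, 'z) module_scheme \<Rightarrow>
      (('r, 't) univ \<Rightarrow> 'b) set monoid"
  where "Ext R i T N = (case chosen_resolution R T of (P, d) \<Rightarrow> Hom_cohomology R P d N i)"

definition grade_at_least :: "('r, 'x) ring_scheme \<Rightarrow> ('r, 't, 'y) module_scheme \<Rightarrow> int \<Rightarrow> bool"
  where "grade_at_least R T c \<longleftrightarrow>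
    (\<forall>i::nat. int i < c \<longrightarrow> trivial_group (Ext R i T (regular_module R)))"

text \<open>The argument of type \<^typ>\<open>'p itself\<close> names the type in which the carrier of \<open>P\<close> lies.
  A theorem that assumes \<open>projective_up_to_grade TYPE('p) R M c\<close> with \<open>'p\<close> a type variable
  covers every \<open>P\<close>.\<close>

definition projective_up_to_grade ::
    "'p itself \<Rightarrow> ('r, 'x) ring_scheme \<Rightarrow> ('r, 'm, 'y) module_scheme \<Rightarrow> int \<Rightarrow> bool"
  where "projective_up_to_grade (_ :: 'p itself) R M c \<longleftrightarrow>
    (\<exists>(P :: ('r, 'p) module) \<pi> A B.
      projective R P \<and> (fin_gen R M \<longrightarrow> fin_gen R P) \<and>
      \<pi> \<in> mod_hom R P M \<and> \<pi> ` carrier P = carrier M \<and> A = a_kernel P M \<pi> \<and>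
      submodule B R P \<and> A \<inter> B = {\<zero>\<^bsub>P\<^esub>} \<and>
      grade_at_least R (quot_module R P (A <+>\<^bsub>P\<^esub> B)) c)"

section \<open>Independence of the chosen type\<close>

lemma mod_homI:
  assumes "\<And>x. x \<in> carrier M \<Longrightarrow> f x \<in> carrier N"
    and "\<And>x y. \<lbrakk>x \<in> carrier M; y \<in> carrier M\<rbrakk> \<Longrightarrow> f (x \<oplus>\<^bsub>M\<^esub> y) = f x \<oplus>\<^bsub>N\<^esub> f y"
    and "\<And>r x. \<lbrakk>r \<in> carrier R; x \<in> carrier M\<rbrakk> \<Longrightarrow> f (r \<odot>\<^bsub>M\<^esub> x) = r \<odot>\<^bsub>N\<^esub> f x"
  shows "f \<in> mod_hom R M N"
  using assms by (auto simp: mod_hom_def hom_def)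

lemma mod_homD:
  assumes "f \<in> mod_hom R M N"
  shows "x \<in> carrier M \<Longrightarrow> f x \<in> carrier N"
    and "\<lbrakk>x \<in> carrier M; y \<in> carrier M\<rbrakk> \<Longrightarrow> f (x \<oplus>\<^bsub>M\<^esub> y) = f x \<oplus>\<^bsub>N\<^esub> f y"
    and "\<lbrakk>r \<in> carrier R; x \<in> carrier M\<rbrakk> \<Longrightarrow> f (r \<odot>\<^bsub>M\<^esub> x) = r \<odot>\<^bsub>N\<^esub> f x"
  using assms by (auto simp: mod_hom_def hom_def)

lemma mod_hom_comp:
  assumes "f \<in> mod_hom R M N" and "g \<in> mod_hom R N L"
  shows "(\<lambda>x. g (f x)) \<in> mod_hom R M L"
  by (rule mod_homI) (simp_all add: mod_homD[OF assms(1)] mod_homD[OF assms(2)])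

lemma mod_hom_zero:
  assumes "left_module R M" "left_module R N" "f \<in> mod_hom R M N"
  shows "f \<zero>\<^bsub>M\<^esub> = \<zero>\<^bsub>N\<^esub>"
proof -
  interpret M: left_module R M by fact
  interpret N: left_module R N by fact
  have "f \<zero>\<^bsub>M\<^esub> \<oplus>\<^bsub>N\<^esub> f \<zero>\<^bsub>M\<^esub> = f \<zero>\<^bsub>M\<^esub>"
    using mod_homD(2)[OF assms(3), of "\<zero>\<^bsub>M\<^esub>" "\<zero>\<^bsub>M\<^esub>"] by simp
  then show ?thesis
    using mod_homD(1)[OF assms(3), of "\<zero>\<^bsub>M\<^esub>"] by simp
qed

lemma left_module_subset:
  assumes "left_module R M" "submodule H R M"
  shows "left_module R (M\<lparr>carrier := H\<rparr>)"
proof -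
  interpret M: left_module R M by fact
  interpret H: submodule H R M by fact
  have sub: "H \<subseteq> carrier M" using H.subset by simp
  have "abelian_group (M\<lparr>carrier := H\<rparr>)"
  proof (rule abelian_groupI)
    fix x assume x: "x \<in> carrier (M\<lparr>carrier := H\<rparr>)"
    have "\<ominus>\<^bsub>M\<^esub> x \<in> H" using H.m_inv_closed[of x] x by (simp add: a_inv_def)
    then show "\<exists>y\<in>carrier (M\<lparr>carrier := H\<rparr>). y \<oplus>\<^bsub>M\<lparr>carrier := H\<rparr>\<^esub> x = \<zero>\<^bsub>M\<lparr>carrier := H\<rparr>\<^esub>"
      using x subsetD[OF sub, of x] by (intro bexI[of _ "\<ominus>\<^bsub>M\<^esub> x"]) (simp_all add: M.M.l_neg)
  qed (use sub H.m_closed H.one_closed in \<open>auto simp: subset_iff M.M.a_ac\<close>)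
  then show ?thesis
    by (intro left_module.intro left_module_axioms.intro M.R.ring_axioms)
      (use sub in \<open>auto simp: subset_iff M.smult_l_distr M.smult_r_distr M.smult_assoc1\<close>)
qed

lemma left_module_smult_zero:
  assumes "left_module R M" and x: "x \<in> carrier M"
  shows "\<zero>\<^bsub>R\<^esub> \<odot>\<^bsub>M\<^esub> x = \<zero>\<^bsub>M\<^esub>"
proof -
  interpret M: left_module R M by fact
  have "\<zero>\<^bsub>R\<^esub> \<odot>\<^bsub>M\<^esub> x \<oplus>\<^bsub>M\<^esub> \<zero>\<^bsub>R\<^esub> \<odot>\<^bsub>M\<^esub> x = \<zero>\<^bsub>R\<^esub> \<odot>\<^bsub>M\<^esub> x"
    using M.smult_l_distr[of "\<zero>\<^bsub>R\<^esub>" "\<zero>\<^bsub>R\<^esub>" x] x by simp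
  then show ?thesis using x by simp
qed

lemma left_module_smult_zero_right:
  assumes "left_module R M" and r: "r \<in> carrier R"
  shows "r \<odot>\<^bsub>M\<^esub> \<zero>\<^bsub>M\<^esub> = \<zero>\<^bsub>M\<^esub>"
proof -
  interpret M: left_module R M by fact
  have "r \<odot>\<^bsub>M\<^esub> \<zero>\<^bsub>M\<^esub> \<oplus>\<^bsub>M\<^esub> r \<odot>\<^bsub>M\<^esub> \<zero>\<^bsub>M\<^esub> = r \<odot>\<^bsub>M\<^esub> \<zero>\<^bsub>M\<^esub>"
    using M.smult_r_distr[of r "\<zero>\<^bsub>M\<^esub>" "\<zero>\<^bsub>M\<^esub>"] r by simp
  then show ?thesis using r by simp
qed

lemma left_module_smult_neg:
  assumes "left_module R M" and r: "r \<in> carrier R" and x: "x \<in> carrier M"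
  shows "r \<odot>\<^bsub>M\<^esub> (\<ominus>\<^bsub>M\<^esub> x) = \<ominus>\<^bsub>M\<^esub> (r \<odot>\<^bsub>M\<^esub> x)"
proof -
  interpret M: left_module R M by fact
  have "r \<odot>\<^bsub>M\<^esub> (\<ominus>\<^bsub>M\<^esub> x) \<oplus>\<^bsub>M\<^esub> r \<odot>\<^bsub>M\<^esub> x = \<zero>\<^bsub>M\<^esub>"
    using M.smult_r_distr[of r "\<ominus>\<^bsub>M\<^esub> x" x] r x
    by (simp add: M.M.l_neg left_module_smult_zero_right[OF assms(1)])
  then show ?thesis using r x by (simp add: M.M.minus_equality)
qed

lemma mod_hom_kernel_submodule:
  assumes "left_module R M" "left_module R N" and f: "f \<in> mod_hom R M N"
  shows "submodule (a_kernel M N f) R M"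
proof -
  interpret M: left_module R M by fact
  interpret N: left_module R N by fact
  have "group_hom (add_monoid M) (add_monoid N) f"
    using f by (intro group_hom.intro group_hom_axioms.intro)
      (auto simp: mod_hom_def intro: M.M.a_group N.M.a_group)
  then have "subgroup (a_kernel M N f) (add_monoid M)"
    unfolding a_kernel_def by (rule group_hom.subgroup_kernel)
  moreover have "r \<odot>\<^bsub>M\<^esub> x \<in> a_kernel M N f" if "r \<in> carrier R" "x \<in> a_kernel M N f" for r x
    using that f by (auto simp: a_kernel_def' mod_homD left_module_smult_zero_right[OF assms(2)])
  ultimately show ?thesis
    by (intro submodule.intro submodule_axioms.intro) auto
qed

subsection \<open>Free modules\<close>

definition free_module :: "('r, 'x) ring_scheme \<Rightarrow> 'a set \<Rightarrow> ('r, 'a \<Rightarrow> 'r) module"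
  where "free_module R S = \<lparr>carrier = {f. f ` S \<subseteq> carrier R \<and> (\<forall>x. x \<notin> S \<longrightarrow> f x = \<zero>\<^bsub>R\<^esub>) \<and>
      finite {x. f x \<noteq> \<zero>\<^bsub>R\<^esub>}},
    mult = undefined, one = undefined, zero = (\<lambda>_. \<zero>\<^bsub>R\<^esub>),
    add = (\<lambda>f g x. f x \<oplus>\<^bsub>R\<^esub> g x), smult = (\<lambda>r f x. r \<otimes>\<^bsub>R\<^esub> f x)\<rparr>"

definition unit_vec :: "('r, 'x) ring_scheme \<Rightarrow> 'a \<Rightarrow> 'a \<Rightarrow> 'r"
  where "unit_vec R s = (\<lambda>x. if x = s then \<one>\<^bsub>R\<^esub> else \<zero>\<^bsub>R\<^esub>)"

definition lin_ext ::
    "('r, 'x) ring_scheme \<Rightarrow> ('r, 'b, 'y) module_scheme \<Rightarrow> ('a \<Rightarrow> 'b) \<Rightarrow> ('a \<Rightarrow> 'r) \<Rightarrow> 'b"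
  where "lin_ext R N n f = (\<Oplus>\<^bsub>N\<^esub>x\<in>{x. f x \<noteq> \<zero>\<^bsub>R\<^esub>}. f x \<odot>\<^bsub>N\<^esub> n x)"

lemma free_carrierD:
  assumes "ring R" "f \<in> carrier (free_module R S)"
  shows "f x \<in> carrier R" "finite {x. f x \<noteq> \<zero>\<^bsub>R\<^esub>}" "{x. f x \<noteq> \<zero>\<^bsub>R\<^esub>} \<subseteq> S"
proof -
  interpret ring R by fact
  show "f x \<in> carrier R" using assms(2) by (cases "x \<in> S") (auto simp: free_module_def)
qed (use assms(2) in \<open>auto simp: free_module_def\<close>)

lemma free_carrierI:
  assumes "\<And>x. f x \<in> carrier R" "finite A" "A \<subseteq> S" "\<And>x. x \<notin> A \<Longrightarrow> f x = \<zero>\<^bsub>R\<^esub>"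
  shows "f \<in> carrier (free_module R S)"
proof -
  have "{x. f x \<noteq> \<zero>\<^bsub>R\<^esub>} \<subseteq> A" using assms(4) by auto
  with assms show ?thesis by (auto simp: free_module_def intro: finite_subset)
qed

lemma free_add_closed:
  assumes "ring R" and f: "f \<in> carrier (free_module R S)" and g: "g \<in> carrier (free_module R S)"
  shows "(\<lambda>x. f x \<oplus>\<^bsub>R\<^esub> g x) \<in> carrier (free_module R S)"
proof -
  interpret ring R by fact
  show ?thesis
    by (rule free_carrierI[of _ _ "{x. f x \<noteq> \<zero>\<^bsub>R\<^esub>} \<union> {x. g x \<noteq> \<zero>\<^bsub>R\<^esub>}"])
      (use free_carrierD[OF assms(1) f] free_carrierD[OF assms(1) g] in auto)
qed

lemma free_smult_closed:
  assumes "ring R" and r: "r \<in> carrier R" and f: "f \<in> carrier (free_module R S)"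
  shows "(\<lambda>x. r \<otimes>\<^bsub>R\<^esub> f x) \<in> carrier (free_module R S)"
proof -
  interpret ring R by fact
  show ?thesis
    by (rule free_carrierI[of _ _ "{x. f x \<noteq> \<zero>\<^bsub>R\<^esub>}"])
      (use r free_carrierD[OF assms(1) f] in auto)
qed

lemma left_module_free:
  assumes "ring R"
  shows "left_module R (free_module R S)"
proof -
  interpret ring R by fact
  note D = free_carrierD[OF assms]
  have neg: "\<exists>g\<in>carrier (free_module R S). (\<lambda>x. g x \<oplus>\<^bsub>R\<^esub> f x) = (\<lambda>_. \<zero>\<^bsub>R\<^esub>)"
    if f: "f \<in> carrier (free_module R S)" for f
  proof
    show "(\<lambda>x. \<ominus>\<^bsub>R\<^esub> f x) \<in> carrier (free_module R S)"
      by (rule free_carrierI[of _ _ "{x. f x \<noteq> \<zero>\<^bsub>R\<^esub>}"]) (use D[OF f] in auto)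
    show "(\<lambda>x. \<ominus>\<^bsub>R\<^esub> f x \<oplus>\<^bsub>R\<^esub> f x) = (\<lambda>_. \<zero>\<^bsub>R\<^esub>)" using D(1)[OF f] by (auto simp: l_neg)
  qed
  have ag: "abelian_group (free_module R S)"
  proof (rule abelian_groupI)
    show "\<zero>\<^bsub>free_module R S\<^esub> \<in> carrier (free_module R S)" by (auto simp: free_module_def)
    show "\<exists>g\<in>carrier (free_module R S). g \<oplus>\<^bsub>free_module R S\<^esub> f = \<zero>\<^bsub>free_module R S\<^esub>"
      if "f \<in> carrier (free_module R S)" for f
      using neg[OF that] by (simp add: free_module_def)
  next
    fix f g assume fg: "f \<in> carrier (free_module R S)" "g \<in> carrier (free_module R S)"
    show "f \<oplus>\<^bsub>free_module R S\<^esub> g \<in> carrier (free_module R S)"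
      using free_add_closed[OF assms fg] by (simp add: free_module_def)
    show "f \<oplus>\<^bsub>free_module R S\<^esub> g = g \<oplus>\<^bsub>free_module R S\<^esub> f"
      using D(1)[OF fg(1)] D(1)[OF fg(2)] by (simp add: free_module_def a_comm)
    fix h assume h: "h \<in> carrier (free_module R S)"
    show "(f \<oplus>\<^bsub>free_module R S\<^esub> g) \<oplus>\<^bsub>free_module R S\<^esub> h = f \<oplus>\<^bsub>free_module R S\<^esub> (g \<oplus>\<^bsub>free_module R S\<^esub> h)"
      using D(1)[OF fg(1)] D(1)[OF fg(2)] D(1)[OF h] by (simp add: free_module_def a_assoc)
  next
    fix f assume f: "f \<in> carrier (free_module R S)"
    show "\<zero>\<^bsub>free_module R S\<^esub> \<oplus>\<^bsub>free_module R S\<^esub> f = f"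
      using D(1)[OF f] by (simp add: free_module_def)
  qed
  show ?thesis
  proof (intro left_module.intro left_module_axioms.intro assms ag)
    fix r f assume rf: "r \<in> carrier R" "f \<in> carrier (free_module R S)"
    show "r \<odot>\<^bsub>free_module R S\<^esub> f \<in> carrier (free_module R S)"
      using free_smult_closed[OF assms rf] by (simp add: free_module_def)
  next
    fix a b f assume "a \<in> carrier R" "b \<in> carrier R" and f: "f \<in> carrier (free_module R S)"
    then show "(a \<oplus>\<^bsub>R\<^esub> b) \<odot>\<^bsub>free_module R S\<^esub> f =
        a \<odot>\<^bsub>free_module R S\<^esub> f \<oplus>\<^bsub>free_module R S\<^esub> b \<odot>\<^bsub>free_module R S\<^esub> f"
      using D(1)[OF f] by (simp add: free_module_def l_distr fun_eq_iff)
  next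
    fix a f g assume a: "a \<in> carrier R" and f: "f \<in> carrier (free_module R S)"
      and g: "g \<in> carrier (free_module R S)"
    then show "a \<odot>\<^bsub>free_module R S\<^esub> (f \<oplus>\<^bsub>free_module R S\<^esub> g) =
        a \<odot>\<^bsub>free_module R S\<^esub> f \<oplus>\<^bsub>free_module R S\<^esub> a \<odot>\<^bsub>free_module R S\<^esub> g"
      using D(1)[OF f] D(1)[OF g] by (simp add: free_module_def r_distr fun_eq_iff)
  next
    fix a b f assume "a \<in> carrier R" "b \<in> carrier R" and f: "f \<in> carrier (free_module R S)"
    then show "(a \<otimes>\<^bsub>R\<^esub> b) \<odot>\<^bsub>free_module R S\<^esub> f = a \<odot>\<^bsub>free_module R S\<^esub> (b \<odot>\<^bsub>free_module R S\<^esub> f)"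
      using D(1)[OF f] by (simp add: free_module_def m_assoc fun_eq_iff)
  next
    fix f assume f: "f \<in> carrier (free_module R S)"
    then show "\<one>\<^bsub>R\<^esub> \<odot>\<^bsub>free_module R S\<^esub> f = f"
      using D(1)[OF f] by (simp add: free_module_def fun_eq_iff)
  qed
qed

lemma unit_vec_closed:
  assumes "ring R" "s \<in> S"
  shows "unit_vec R s \<in> carrier (free_module R S)"
proof -
  interpret ring R by fact
  show ?thesis by (rule free_carrierI[of _ _ "{s}"]) (use assms in \<open>auto simp: unit_vec_def\<close>)
qed

lemma lin_ext_superset:
  assumes "left_module R N" "finite A" "{x. f x \<noteq> \<zero>\<^bsub>R\<^esub>} \<subseteq> A" "n \<in> A \<rightarrow> carrier N"
    and "\<And>x. f x \<in> carrier R"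
  shows "lin_ext R N n f = (\<Oplus>\<^bsub>N\<^esub>x\<in>A. f x \<odot>\<^bsub>N\<^esub> n x)"
proof -
  interpret N: left_module R N by fact
  show ?thesis unfolding lin_ext_def
    by (rule N.M.add.finprod_mono_neutral_cong_left)
      (use assms in \<open>auto simp: left_module_smult_zero[OF assms(1)] Pi_def\<close>)
qed

lemma lin_ext_hom:
  assumes "left_module R N" and n: "n \<in> S \<rightarrow> carrier N"
  shows "lin_ext R N n \<in> mod_hom R (free_module R S) N"
proof -
  interpret N: left_module R N by fact
  note D = free_carrierD[OF N.R.ring_axioms]
  show ?thesis
  proof (rule mod_homI)
    fix f assume f: "f \<in> carrier (free_module R S)"
    then show "lin_ext R N n f \<in> carrier N"
      unfolding lin_ext_def using D(1,3)[OF f] n by (intro N.M.finsum_closed) auto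
  next
    fix f g assume f: "f \<in> carrier (free_module R S)" and g: "g \<in> carrier (free_module R S)"
    let ?A = "{x. f x \<noteq> \<zero>\<^bsub>R\<^esub>} \<union> {x. g x \<noteq> \<zero>\<^bsub>R\<^esub>}"
    have A: "finite ?A" "?A \<subseteq> S" using D[OF f] D[OF g] by auto
    have nA: "n \<in> ?A \<rightarrow> carrier N" using A n by auto
    have sub: "{x. f x \<oplus>\<^bsub>R\<^esub> g x \<noteq> \<zero>\<^bsub>R\<^esub>} \<subseteq> ?A" by auto
    have "lin_ext R N n (f \<oplus>\<^bsub>free_module R S\<^esub> g) = lin_ext R N n (\<lambda>x. f x \<oplus>\<^bsub>R\<^esub> g x)"
      by (simp add: free_module_def)
    also have "\<dots> = (\<Oplus>\<^bsub>N\<^esub>x\<in>?A. (f x \<oplus>\<^bsub>R\<^esub> g x) \<odot>\<^bsub>N\<^esub> n x)"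
      by (rule lin_ext_superset[OF assms(1) A(1) sub nA]) (use D[OF f] D[OF g] in auto)
    also have "\<dots> = (\<Oplus>\<^bsub>N\<^esub>x\<in>?A. f x \<odot>\<^bsub>N\<^esub> n x \<oplus>\<^bsub>N\<^esub> g x \<odot>\<^bsub>N\<^esub> n x)"
      by (rule N.M.finsum_cong')
        (use D(1)[OF f] D(1)[OF g] nA in \<open>auto simp: N.smult_l_distr Pi_iff\<close>)
    also have "\<dots> = (\<Oplus>\<^bsub>N\<^esub>x\<in>?A. f x \<odot>\<^bsub>N\<^esub> n x) \<oplus>\<^bsub>N\<^esub> (\<Oplus>\<^bsub>N\<^esub>x\<in>?A. g x \<odot>\<^bsub>N\<^esub> n x)"
      by (rule N.M.finsum_addf) (use D(1)[OF f] D(1)[OF g] nA in \<open>auto simp: Pi_iff\<close>)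
    also have "(\<Oplus>\<^bsub>N\<^esub>x\<in>?A. f x \<odot>\<^bsub>N\<^esub> n x) = lin_ext R N n f"
      by (rule lin_ext_superset[symmetric, OF assms(1) A(1) _ nA]) (use D[OF f] in auto)
    also have "(\<Oplus>\<^bsub>N\<^esub>x\<in>?A. g x \<odot>\<^bsub>N\<^esub> n x) = lin_ext R N n g"
      by (rule lin_ext_superset[symmetric, OF assms(1) A(1) _ nA]) (use D[OF g] in auto)
    finally show "lin_ext R N n (f \<oplus>\<^bsub>free_module R S\<^esub> g) = lin_ext R N n f \<oplus>\<^bsub>N\<^esub> lin_ext R N n g" .
  next
    fix r f assume r: "r \<in> carrier R" and f: "f \<in> carrier (free_module R S)"
    let ?A = "{x. f x \<noteq> \<zero>\<^bsub>R\<^esub>}"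
    have A: "finite ?A" "?A \<subseteq> S" using D[OF f] by auto
    have nA: "n \<in> ?A \<rightarrow> carrier N" using A n by auto
    have sub: "{x. r \<otimes>\<^bsub>R\<^esub> f x \<noteq> \<zero>\<^bsub>R\<^esub>} \<subseteq> ?A" using r by auto
    have fs: "r \<odot>\<^bsub>N\<^esub> (\<Oplus>\<^bsub>N\<^esub>x\<in>B. h x) = (\<Oplus>\<^bsub>N\<^esub>x\<in>B. r \<odot>\<^bsub>N\<^esub> h x)"
      if "finite B" "B \<subseteq> S" "h \<in> B \<rightarrow> carrier N" for B h
      using that
    proof (induction B)
      case empty
      show ?case using left_module_smult_zero_right[OF assms(1) r] by simp
    next
      case (insert b B)
      then show ?case using r by (simp add: Pi_def N.smult_r_distr)
    qed
    have "lin_ext R N n (r \<odot>\<^bsub>free_module R S\<^esub> f) = lin_ext R N n (\<lambda>x. r \<otimes>\<^bsub>R\<^esub> f x)"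
      by (simp add: free_module_def)
    also have "\<dots> = (\<Oplus>\<^bsub>N\<^esub>x\<in>?A. (r \<otimes>\<^bsub>R\<^esub> f x) \<odot>\<^bsub>N\<^esub> n x)"
      by (rule lin_ext_superset[OF assms(1) A(1) sub nA]) (use r D[OF f] in auto)
    also have "\<dots> = (\<Oplus>\<^bsub>N\<^esub>x\<in>?A. r \<odot>\<^bsub>N\<^esub> (f x \<odot>\<^bsub>N\<^esub> n x))"
      by (rule N.M.finsum_cong') (use r D(1)[OF f] nA in \<open>auto simp: N.smult_assoc1 Pi_iff\<close>)
    also have "\<dots> = r \<odot>\<^bsub>N\<^esub> (\<Oplus>\<^bsub>N\<^esub>x\<in>?A. f x \<odot>\<^bsub>N\<^esub> n x)"
      by (rule fs[symmetric, OF A]) (use D(1)[OF f] nA in \<open>auto simp: Pi_iff\<close>)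
    finally show "lin_ext R N n (r \<odot>\<^bsub>free_module R S\<^esub> f) = r \<odot>\<^bsub>N\<^esub> lin_ext R N n f"
      by (simp add: lin_ext_def)
  qed
qed

lemma lin_ext_unit_vec:
  assumes "left_module R N" "n s \<in> carrier N"
  shows "lin_ext R N n (unit_vec R s) = n s"
proof -
  interpret N: left_module R N by fact
  have "lin_ext R N n (unit_vec R s) = (\<Oplus>\<^bsub>N\<^esub>x\<in>{s}. unit_vec R s x \<odot>\<^bsub>N\<^esub> n x)"
    by (rule lin_ext_superset[OF assms(1)]) (use assms in \<open>auto simp: unit_vec_def\<close>)
  then show ?thesis using assms(2) by (simp add: unit_vec_def)
qed

lemma mod_hom_finsum:
  assumes "left_module R M" "left_module R N" "g \<in> mod_hom R M N" "finite A" "h \<in> A \<rightarrow> carrier M"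
  shows "g (\<Oplus>\<^bsub>M\<^esub>x\<in>A. h x) = (\<Oplus>\<^bsub>N\<^esub>x\<in>A. g (h x))"
proof -
  interpret M: left_module R M by fact
  interpret N: left_module R N by fact
  show ?thesis using assms(4,5)
  proof (induction A)
    case empty
    show ?case using mod_hom_zero[OF assms(1-3)] by simp
  next
    case (insert a A)
    then show ?case
      using mod_homD[OF assms(3)] by (simp add: Pi_def)
  qed
qed

lemma lin_ext_natural:
  assumes "left_module R M" "left_module R N" "g \<in> mod_hom R M N" "n \<in> S \<rightarrow> carrier M"
    and f: "f \<in> carrier (free_module R S)"
  shows "g (lin_ext R M n f) = lin_ext R N (\<lambda>x. g (n x)) f"
proof -
  interpret M: left_module R M by fact
  interpret N: left_module R N by fact
  note D = free_carrierD[OF M.R.ring_axioms f]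
  have "g (lin_ext R M n f) = (\<Oplus>\<^bsub>N\<^esub>x\<in>{x. f x \<noteq> \<zero>\<^bsub>R\<^esub>}. g (f x \<odot>\<^bsub>M\<^esub> n x))"
    unfolding lin_ext_def
    by (rule mod_hom_finsum[OF assms(1-3)]) (use D assms(4) in auto)
  also have "\<dots> = (\<Oplus>\<^bsub>N\<^esub>x\<in>{x. f x \<noteq> \<zero>\<^bsub>R\<^esub>}. f x \<odot>\<^bsub>N\<^esub> g (n x))"
  proof (rule N.M.finsum_cong')
    fix x assume "x \<in> {x. f x \<noteq> \<zero>\<^bsub>R\<^esub>}"
    then have "n x \<in> carrier M" using D(3) assms(4) by auto
    then show "g (f x \<odot>\<^bsub>M\<^esub> n x) = f x \<odot>\<^bsub>N\<^esub> g (n x)"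
      using D(1) by (intro mod_homD(3)[OF assms(3)])
  qed (use D assms(4) mod_homD(1)[OF assms(3)] in \<open>auto intro!: N.smult_closed\<close>)
  finally show ?thesis by (simp add: lin_ext_def)
qed

lemma lin_ext_id:
  assumes "ring R" and f: "f \<in> carrier (free_module R S)"
  shows "lin_ext R (free_module R S) (unit_vec R) f = f"
proof
  fix y
  interpret ring R by fact
  interpret F: left_module R "free_module R S" by (rule left_module_free[OF assms(1)])
  note D = free_carrierD[OF assms]
  have ev: "(\<Oplus>\<^bsub>free_module R S\<^esub>x\<in>A. h x) y = (\<Oplus>\<^bsub>R\<^esub>x\<in>A. h x y)"
    if "finite A" "A \<subseteq> S" "h \<in> A \<rightarrow> carrier (free_module R S)" for A h
    using that
  proof (induction A)
    case empty
    show ?case unfolding F.M.finsum_empty by (simp add: free_module_def)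
  next
    case (insert a A)
    have cl: "h x y \<in> carrier R" if "x \<in> insert a A" for x
      using insert.prems that free_carrierD(1)[OF assms(1), of "h x" S] by blast
    have "(\<Oplus>\<^bsub>free_module R S\<^esub>x\<in>insert a A. h x) y =
        (h a \<oplus>\<^bsub>free_module R S\<^esub> (\<Oplus>\<^bsub>free_module R S\<^esub>x\<in>A. h x)) y"
      using insert by (subst F.M.finsum_insert) auto
    also have "\<dots> = h a y \<oplus>\<^bsub>R\<^esub> (\<Oplus>\<^bsub>free_module R S\<^esub>x\<in>A. h x) y" by (simp add: free_module_def)
    finally show ?case using insert cl by (simp add: Pi_def)
  qed
  have "lin_ext R (free_module R S) (unit_vec R) f y =
      (\<Oplus>\<^bsub>R\<^esub>x\<in>{x. f x \<noteq> \<zero>\<^bsub>R\<^esub>}. (f x \<odot>\<^bsub>free_module R S\<^esub> unit_vec R x) y)"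
    unfolding lin_ext_def
    by (rule ev) (use D in \<open>auto intro!: F.smult_closed unit_vec_closed[OF assms(1)]\<close>)
  also have "\<dots> = (\<Oplus>\<^bsub>R\<^esub>x\<in>insert y {x. f x \<noteq> \<zero>\<^bsub>R\<^esub>}. if y = x then f x else \<zero>\<^bsub>R\<^esub>)"
    by (rule add.finprod_mono_neutral_cong_left)
      (use D in \<open>auto simp: free_module_def unit_vec_def\<close>)
  also have "\<dots> = f y" by (rule finsum_singleton) (use D in auto)
  finally show "lin_ext R (free_module R S) (unit_vec R) f y = f y" .
qed

lemma free_hom_eq_lin_ext:
  assumes "left_module R N" "g \<in> mod_hom R (free_module R S) N"
    and f: "f \<in> carrier (free_module R S)"
  shows "g f = lin_ext R N (\<lambda>s. g (unit_vec R s)) f"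
proof -
  interpret N: left_module R N by fact
  note F = left_module_free[OF N.R.ring_axioms, of S]
  have "g f = g (lin_ext R (free_module R S) (unit_vec R) f)"
    using lin_ext_id[OF N.R.ring_axioms f] by simp
  also have "\<dots> = lin_ext R N (\<lambda>s. g (unit_vec R s)) f"
    by (rule lin_ext_natural[OF F assms(1,2) _ f]) (auto intro: unit_vec_closed[OF N.R.ring_axioms])
  finally show ?thesis .
qed

lemma free_lifting:
  assumes "left_module R N" "left_module R L" "g \<in> mod_hom R N L" "g ` carrier N = carrier L"
    and f: "f \<in> mod_hom R (free_module R S) L"
  shows "\<exists>h\<in>mod_hom R (free_module R S) N. \<forall>x\<in>carrier (free_module R S). g (h x) = f x"
proof -
  interpret N: left_module R N by fact
  have "\<forall>s\<in>S. \<exists>n\<in>carrier N. g n = f (unit_vec R s)"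
    using assms(4) mod_homD(1)[OF f] unit_vec_closed[OF N.R.ring_axioms] by (metis imageE)
  then obtain n where n: "\<And>s. s \<in> S \<Longrightarrow> n s \<in> carrier N \<and> g (n s) = f (unit_vec R s)" by metis
  have "g (lin_ext R N n x) = f x" if x: "x \<in> carrier (free_module R S)" for x
  proof -
    note D = free_carrierD[OF N.R.ring_axioms x]
    have "g (lin_ext R N n x) = lin_ext R L (\<lambda>s. g (n s)) x"
      by (rule lin_ext_natural[OF assms(1-3) _ x]) (use n in auto)
    also have "\<dots> = lin_ext R L (\<lambda>s. f (unit_vec R s)) x"
    proof -
      interpret L: left_module R L by fact
      show ?thesis unfolding lin_ext_def
        by (rule L.M.finsum_cong')
          (use n D in \<open>auto intro!: L.smult_closed mod_homD(1)[OF f] unit_vec_closed[OF N.R.ring_axioms]\<close>)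
    qed
    also have "\<dots> = f x" by (rule free_hom_eq_lin_ext[symmetric, OF assms(2) f x])
    finally show ?thesis .
  qed
  then show ?thesis using lin_ext_hom[OF assms(1), of n S] n by auto
qed

subsection \<open>Transport of structure\<close>

definition transport :: "('a \<Rightarrow> 'b) \<Rightarrow> ('r, 'a, 'y) module_scheme \<Rightarrow> ('r, 'b) module"
  where "transport e M = \<lparr>carrier = e ` carrier M, mult = undefined, one = undefined,
    zero = e \<zero>\<^bsub>M\<^esub>,
    add = (\<lambda>x y. e (inv_into (carrier M) e x \<oplus>\<^bsub>M\<^esub> inv_into (carrier M) e y)),
    smult = (\<lambda>r x. e (r \<odot>\<^bsub>M\<^esub> inv_into (carrier M) e x))\<rparr>"

lemma transport_module:
  assumes "left_module R M" and e: "inj_on e (carrier M)"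
  shows "left_module R (transport e M)"
proof -
  interpret M: left_module R M by fact
  note [simp] = inv_into_f_f[OF e] transport_def
  have "abelian_group (transport e M)"
  proof (rule abelian_groupI)
    fix x assume "x \<in> carrier (transport e M)"
    then obtain a where a: "a \<in> carrier M" "x = e a" by auto
    then show "\<exists>y\<in>carrier (transport e M). y \<oplus>\<^bsub>transport e M\<^esub> x = \<zero>\<^bsub>transport e M\<^esub>"
      by (intro bexI[of _ "e (\<ominus>\<^bsub>M\<^esub> a)"]) (auto simp: M.M.l_neg)
  qed (auto simp: M.M.a_ac)
  then show ?thesis
    by (intro left_module.intro left_module_axioms.intro M.R.ring_axioms)
      (auto simp: M.smult_l_distr M.smult_r_distr M.smult_assoc1)
qed

lemma transport_hom:
  assumes "left_module R M" and e: "inj_on e (carrier M)"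
  shows "e \<in> mod_hom R M (transport e M)"
    and "inv_into (carrier M) e \<in> mod_hom R (transport e M) M"
proof -
  interpret M: left_module R M by fact
  note [simp] = inv_into_f_f[OF e] transport_def
  show "e \<in> mod_hom R M (transport e M)" by (rule mod_homI) auto
  show "inv_into (carrier M) e \<in> mod_hom R (transport e M) M" by (rule mod_homI) auto
qed

definition encode :: "('r, 'x) ring_scheme \<Rightarrow> (('r, 'a) univ \<Rightarrow> 'r) \<Rightarrow> ('r, 'a) univ"
  where "encode R f = Comb (SOME xs. set xs = {(f s, s) |s. f s \<noteq> \<zero>\<^bsub>R\<^esub>})"

lemma inj_on_encode:
  fixes R :: "('r, 'x) ring_scheme" and S :: "('r, 'a) univ set"
  shows "inj_on (encode R) (carrier (free_module R S))"
proof (rule inj_onI)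
  fix f g assume fg: "f \<in> carrier (free_module R S)" "g \<in> carrier (free_module R S)"
    and eq: "encode R f = encode R g"
  let ?X = "\<lambda>f. {(f s, s) |s. f s \<noteq> \<zero>\<^bsub>R\<^esub>}"
  have set: "set (SOME xs. set xs = ?X h) = ?X h" if "h \<in> carrier (free_module R S)" for h
  proof -
    have "finite ((\<lambda>s. (h s, s)) ` {s. h s \<noteq> \<zero>\<^bsub>R\<^esub>})"
      using that by (simp add: free_module_def)
    then have "finite (?X h)" by (simp add: setcompr_eq_image)
    then show ?thesis using finite_list[of "?X h"] by (metis (mono_tags, lifting) someI_ex)
  qed
  have "(SOME xs. set xs = ?X f) = (SOME xs. set xs = ?X g)"
    using eq unfolding encode_def by (rule univ.inject(2)[THEN iffD1])
  from arg_cong[OF this, of set] have X: "?X f = ?X g"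
    unfolding set[OF fg(1)] set[OF fg(2)] .
  show "f = g"
  proof
    fix s
    have mem: "(a, s) \<in> ?X h \<longleftrightarrow> a = h s \<and> h s \<noteq> \<zero>\<^bsub>R\<^esub>"
      for a and h :: "('r, 'a) univ \<Rightarrow> 'r" by auto
    have "a = f s \<and> f s \<noteq> \<zero>\<^bsub>R\<^esub> \<longleftrightarrow> a = g s \<and> g s \<noteq> \<zero>\<^bsub>R\<^esub>" for a
      using X mem[of a f] mem[of a g] by (simp only:)
    then show "f s = g s" by metis
  qed
qed

abbreviation free_univ :: "('r, 'x) ring_scheme \<Rightarrow> ('r, 'a) univ set \<Rightarrow> ('r, ('r, 'a) univ) module"
  where "free_univ R S \<equiv> transport (encode R) (free_module R S)"

lemma free_univ_lifting:
  assumes "left_module R N" "left_module R L" "g \<in> mod_hom R N L" "g ` carrier N = carrier L"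
    and f: "f \<in> mod_hom R (free_univ R S) L"
  shows "\<exists>h\<in>mod_hom R (free_univ R S) N. \<forall>x\<in>carrier (free_univ R S). g (h x) = f x"
proof -
  interpret N: left_module R N by fact
  let ?e = "encode R" and ?i = "inv_into (carrier (free_module R S)) (encode R)"
  note F = left_module_free[OF N.R.ring_axioms, of S]
  note t = transport_hom[OF F inj_on_encode]
  obtain h where h: "h \<in> mod_hom R (free_module R S) N"
    "\<And>x. x \<in> carrier (free_module R S) \<Longrightarrow> g (h x) = f (?e x)"
    using free_lifting[OF assms(1-4) mod_hom_comp[OF t(1) f]] by auto
  have "g (h (?i x)) = f x" if "x \<in> carrier (free_univ R S)" for x
    using that h(2) by (auto simp: transport_def inv_into_f_f[OF inj_on_encode])
  then show ?thesis by (intro bexI[OF _ mod_hom_comp[OF t(2) h(1)]]) blast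
qed

lemma free_univ_module: "ring R \<Longrightarrow> left_module R (free_univ R S)"
  by (intro transport_module left_module_free inj_on_encode)

lemma projective_free_univ: "ring R \<Longrightarrow> projective R (free_univ R S)"
  unfolding projective_def by (intro conjI allI impI ballI free_univ_module free_univ_lifting)

lemma free_univ_cover:
  assumes "left_module R N" "n ` S = carrier N"
  shows "\<exists>p\<in>mod_hom R (free_univ R S) N. p ` carrier (free_univ R S) = carrier N"
proof -
  interpret N: left_module R N by fact
  let ?i = "inv_into (carrier (free_module R S)) (encode R)"
  note F = left_module_free[OF N.R.ring_axioms, of S]
  note t = transport_hom[OF F inj_on_encode]
  have n: "n \<in> S \<rightarrow> carrier N" using assms(2) by auto
  note l = lin_ext_hom[OF assms(1) n]
  have p: "(\<lambda>x. lin_ext R N n (?i x)) \<in> mod_hom R (free_univ R S) N"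
    by (rule mod_hom_comp[OF t(2) l])
  have "y \<in> (\<lambda>x. lin_ext R N n (?i x)) ` carrier (free_univ R S)" if y: "y \<in> carrier N" for y
  proof -
    obtain s where s: "s \<in> S" "n s = y"
      using y unfolding assms(2)[symmetric] by (elim imageE) simp
    have u: "unit_vec R s \<in> carrier (free_module R S)"
      by (rule unit_vec_closed[OF N.R.ring_axioms s(1)])
    have "lin_ext R N n (?i (encode R (unit_vec R s))) = y"
      using s y lin_ext_unit_vec[OF assms(1), of n s] by (simp add: inv_into_f_f[OF inj_on_encode u])
    moreover have "encode R (unit_vec R s) \<in> carrier (free_univ R S)"
      using u by (simp add: transport_def)
    ultimately show ?thesis by (intro image_eqI[where x = "encode R (unit_vec R s)"]) simp_all
  qed
  then have "(\<lambda>x. lin_ext R N n (?i x)) ` carrier (free_univ R S) = carrier N"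
    by (intro equalityI subsetI) (auto intro: mod_homD(1)[OF p])
  then show ?thesis by (intro bexI[OF _ p])
qed

theorem projective_lift:
  fixes R :: "('r, 'x) ring_scheme" and P :: "('r, 'a, 'w) module_scheme"
    and N :: "('r, 'b, 'y) module_scheme" and L :: "('r, 'c, 'z) module_scheme"
  assumes P: "projective R P" and N: "left_module R N" and L: "left_module R L"
    and g: "g \<in> mod_hom R N L" "g ` carrier N = carrier L" and f: "f \<in> mod_hom R P L"
  shows "\<exists>h\<in>mod_hom R P N. \<forall>x\<in>carrier P. g (h x) = f x"
proof -
  have PM: "left_module R P" using P by (simp add: projective_def)
  interpret P: left_module R P by (rule PM)
  let ?gen = "Gen :: 'a \<Rightarrow> ('r, 'a) univ"
  let ?S = "?gen ` carrier P" and ?i = "inv_into (carrier P) ?gen"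
  let ?F = "free_univ R ?S"
  have inj: "inj_on ?gen (carrier P)" by (rule inj_onI) simp
  note t = transport_hom[OF PM inj]
  have T: "left_module R (transport ?gen P)" by (rule transport_module[OF PM inj])
  have "id ` ?S = carrier (transport ?gen P)" by (simp add: transport_def)
  from free_univ_cover[OF T this] obtain p where p: "p \<in> mod_hom R ?F (transport ?gen P)"
    "p ` carrier ?F = carrier (transport ?gen P)" by blast
  note FM = free_univ_module[OF P.R.ring_axioms, of ?S]
  obtain s where s: "s \<in> mod_hom R P ?F" "\<And>x. x \<in> carrier P \<Longrightarrow> p (s x) = ?gen x"
    using P[unfolded projective_def, THEN conjunct2, rule_format, OF FM T p(1) t(1) p(2)] by blast
  have "(\<lambda>x. f (?i (p x))) \<in> mod_hom R ?F L"
    by (rule mod_hom_comp[OF p(1) mod_hom_comp[OF t(2) f]])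
  from free_univ_lifting[OF N L g this] obtain k where k: "k \<in> mod_hom R ?F N"
    "\<And>x. x \<in> carrier ?F \<Longrightarrow> g (k x) = f (?i (p x))" by blast
  have "g (k (s x)) = f x" if x: "x \<in> carrier P" for x
    using k(2)[OF mod_homD(1)[OF s(1) x]] s(2)[OF x] inv_into_f_f[OF inj x] by simp
  then show ?thesis by (intro bexI[OF _ mod_hom_comp[OF s(1) k(1)]] ballI)
qed

theorem ex_proj_resolution:
  fixes R :: "('r, 'x) ring_scheme" and T :: "('r, 't, 'y) module_scheme"
  assumes T: "left_module R T"
  shows "\<exists>(P :: nat \<Rightarrow> ('r, ('r, 't) univ) module) d \<epsilon>. proj_resolution R T P d \<epsilon>"
proof -
  interpret T: left_module R T by (rule T)
  note FM = free_univ_module[OF T.R.ring_axioms]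
  have "(inv_into (carrier T) Gen) ` (Gen ` carrier T) = carrier T"
    by (simp add: image_image inv_into_f_f inj_on_def)
  from free_univ_cover[OF T this] obtain \<epsilon>
    where \<epsilon>: "\<epsilon> \<in> mod_hom R (free_univ R (Gen ` carrier T)) T"
      "\<epsilon> ` carrier (free_univ R (Gen ` carrier T)) = carrier T" by blast
  have step: "\<exists>q\<in>mod_hom R (free_univ R K) (free_univ R S). q ` carrier (free_univ R K) = K"
    if K: "submodule K R (free_univ R S)" for K S :: "('r, 't) univ set"
  proof -
    have sub: "K \<subseteq> carrier (free_univ R S)" using submodule.axioms(1)[OF K] subgroup.subset by force
    have "id ` K = carrier ((free_univ R S)\<lparr>carrier := K\<rparr>)" by simp
    from free_univ_cover[OF left_module_subset[OF FM K] this] obtain q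
      where q: "q \<in> mod_hom R (free_univ R K) ((free_univ R S)\<lparr>carrier := K\<rparr>)"
        "q ` carrier (free_univ R K) = K" by auto
    have "q \<in> mod_hom R (free_univ R K) (free_univ R S)"
      using mod_homD[OF q(1)] sub by (intro mod_homI) auto
    then show ?thesis using q(2) by blast
  qed
  define S0 where "S0 = (Gen ` carrier T :: ('r, 't) univ set)"
  define K0 where "K0 = a_kernel (free_univ R S0) T \<epsilon>"
  have K0: "submodule K0 R (free_univ R S0)"
    unfolding K0_def by (rule mod_hom_kernel_submodule[OF FM T]) (use \<epsilon> S0_def in simp)
  define cov where "cov = (\<lambda>S K. SOME q. q \<in> mod_hom R (free_univ R K) (free_univ R S) \<and>
    q ` carrier (free_univ R K) = (K :: ('r, 't) univ set))"
  have cov: "cov S K \<in> mod_hom R (free_univ R K) (free_univ R S)"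
    "cov S K ` carrier (free_univ R K) = K" if "submodule K R (free_univ R S)" for K S
  proof -
    have "\<exists>q. q \<in> mod_hom R (free_univ R K) (free_univ R S) \<and> q ` carrier (free_univ R K) = K"
      using step[OF that] by blast
    from someI_ex[OF this] show "cov S K \<in> mod_hom R (free_univ R K) (free_univ R S)"
      "cov S K ` carrier (free_univ R K) = K" unfolding cov_def by auto
  qed
  define st where "st = rec_nat (S0, K0)
    (\<lambda>_ (S, K). (K, a_kernel (free_univ R K) (free_univ R S) (cov S K)))"
  have st0: "st 0 = (S0, K0)" and stS: "st (Suc n) = (snd (st n),
    a_kernel (free_univ R (snd (st n))) (free_univ R (fst (st n))) (cov (fst (st n)) (snd (st n))))" for n
    by (simp_all add: st_def case_prod_beta)
  define P where "P n = free_univ R (fst (st n))" for n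
  define d where "d n = cov (fst (st n)) (snd (st n))" for n
  have sub: "submodule (snd (st n)) R (free_univ R (fst (st n)))" for n
  proof (induction n)
    case 0
    show ?case using K0 by (simp add: st0)
  next
    case (Suc n)
    show ?case using mod_hom_kernel_submodule[OF FM FM cov(1)[OF Suc]] by (simp add: stS)
  qed
  have "proj_resolution R T P d \<epsilon>"
    unfolding proj_resolution_def
  proof (intro conjI allI)
    show "projective R (P n)" for n unfolding P_def by (rule projective_free_univ[OF T.R.ring_axioms])
    show "\<epsilon> \<in> mod_hom R (P 0) T" "\<epsilon> ` carrier (P 0) = carrier T"
      using \<epsilon> by (simp_all add: P_def st0 S0_def)
    show "d n \<in> mod_hom R (P (Suc n)) (P n)" for n
      using cov(1)[OF sub[of n]] by (simp add: P_def d_def stS)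
    show "d 0 ` carrier (P 1) = a_kernel (P 0) T \<epsilon>"
      using cov(2)[OF sub[of 0]] by (simp add: P_def d_def stS st0 K0_def)
    show "d (Suc n) ` carrier (P (Suc (Suc n))) = a_kernel (P (Suc n)) (P n) (d n)" for n
      using cov(2)[OF sub[of "Suc n"]] by (simp add: P_def d_def stS)
  qed
  then show ?thesis by blast
qed

lemma chosen_resolution:
  fixes R :: "('r, 'x) ring_scheme" and T :: "('r, 't, 'y) module_scheme"
  assumes "left_module R T" "chosen_resolution R T = (P, d)"
  shows "\<exists>\<epsilon>. proj_resolution R T P d \<epsilon>"
proof -
  let ?res = "\<lambda>(P, d). \<exists>\<epsilon>. proj_resolution R T P d \<epsilon>"
  from ex_proj_resolution[OF assms(1)] obtain P' d' \<epsilon>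
    where "proj_resolution R T P' (d' :: nat \<Rightarrow> ('r, 't) univ \<Rightarrow> ('r, 't) univ) \<epsilon>" by (elim exE)
  then have "?res (P', d')" unfolding case_prod_conv by - (rule exI)
  then have "?res (chosen_resolution R T)" unfolding chosen_resolution_def by (rule someI)
  then show ?thesis unfolding assms(2) case_prod_conv .
qed

lemma Hom_comm_group:
  assumes "left_module R M" "left_module R N"
  shows "comm_group (Hom_group R M N)"
proof -
  interpret M: left_module R M by fact
  interpret N: left_module R N by fact
  note H = mod_homD[where M = M and N = N and R = R]
  let ?G = "Hom_group R M N"
  show ?thesis
  proof (rule comm_groupI)
    fix f g assume fg: "f \<in> carrier ?G" "g \<in> carrier ?G"
    then have f: "f \<in> mod_hom R M N" and g: "g \<in> mod_hom R M N" by (auto simp: Hom_group_def)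
    have "(\<lambda>x\<in>carrier M. f x \<oplus>\<^bsub>N\<^esub> g x) \<in> mod_hom R M N"
      by (rule mod_homI) (simp_all add: H[OF f] H[OF g] N.smult_r_distr N.M.a_ac)
    then show "f \<otimes>\<^bsub>?G\<^esub> g \<in> carrier ?G" by (simp add: Hom_group_def)
    show "f \<otimes>\<^bsub>?G\<^esub> g = g \<otimes>\<^bsub>?G\<^esub> f"
      by (auto simp: Hom_group_def H[OF f] H[OF g] N.M.a_comm intro!: restrict_ext)
    fix h assume "h \<in> carrier ?G"
    then have h: "h \<in> mod_hom R M N" by (simp add: Hom_group_def)
    show "f \<otimes>\<^bsub>?G\<^esub> g \<otimes>\<^bsub>?G\<^esub> h = f \<otimes>\<^bsub>?G\<^esub> (g \<otimes>\<^bsub>?G\<^esub> h)"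
      by (auto simp: Hom_group_def H[OF f] H[OF g] H[OF h] N.M.a_assoc intro!: restrict_ext)
  next
    have "(\<lambda>x\<in>carrier M. \<zero>\<^bsub>N\<^esub>) \<in> mod_hom R M N"
      by (rule mod_homI) (simp_all add: left_module_smult_zero_right[OF assms(2)])
    then show "\<one>\<^bsub>?G\<^esub> \<in> carrier ?G" by (simp add: Hom_group_def)
  next
    fix f assume "f \<in> carrier ?G"
    then have f: "f \<in> mod_hom R M N" "f \<in> extensional (carrier M)" by (auto simp: Hom_group_def)
    show "\<one>\<^bsub>?G\<^esub> \<otimes>\<^bsub>?G\<^esub> f = f"
      using f(2) by (intro ext) (auto simp: Hom_group_def H[OF f(1)] extensional_def)
    have "(\<lambda>x\<in>carrier M. \<ominus>\<^bsub>N\<^esub> f x) \<in> mod_hom R M N"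
      by (rule mod_homI)
        (simp_all add: H[OF f(1)] left_module_smult_neg[OF assms(2)] N.M.minus_add N.M.a_comm)
    then show "\<exists>g\<in>carrier ?G. g \<otimes>\<^bsub>?G\<^esub> f = \<one>\<^bsub>?G\<^esub>"
      by (intro bexI[of _ "\<lambda>x\<in>carrier M. \<ominus>\<^bsub>N\<^esub> f x"])
        (auto simp: Hom_group_def H[OF f(1)] N.M.l_neg intro!: restrict_ext)
  qed
qed

lemma Hom_group_inv:
  assumes "left_module R M" "left_module R N" and f: "f \<in> carrier (Hom_group R M N)"
    and x: "x \<in> carrier M"
  shows "(inv\<^bsub>Hom_group R M N\<^esub> f) x = \<ominus>\<^bsub>N\<^esub> f x"
proof -
  interpret N: left_module R N by fact
  interpret G: comm_group "Hom_group R M N" by (rule Hom_comm_group[OF assms(1,2)])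
  let ?g = "inv\<^bsub>Hom_group R M N\<^esub> f"
  have g: "?g \<in> carrier (Hom_group R M N)" using f by simp
  have "?g x \<oplus>\<^bsub>N\<^esub> f x = (?g \<otimes>\<^bsub>Hom_group R M N\<^esub> f) x" using x by (simp add: Hom_group_def)
  also have "\<dots> = \<zero>\<^bsub>N\<^esub>" unfolding G.l_inv[OF f] using x by (simp add: Hom_group_def)
  finally have "?g x \<oplus>\<^bsub>N\<^esub> f x = \<zero>\<^bsub>N\<^esub>" .
  moreover have "f x \<in> carrier N" "?g x \<in> carrier N"
    using f g mod_homD(1)[OF _ x] by (auto simp: Hom_group_def)
  ultimately show ?thesis by (simp add: N.M.minus_equality)
qed

theorem Ext_group:
  fixes R :: "('r, 'x) ring_scheme" and T :: "('r, 't, 'y) module_scheme"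
    and N :: "('r, 'b, 'z) module_scheme"
  assumes T: "left_module R T" and N: "left_module R N"
  shows "group (Ext R i T N)"
proof -
  interpret N: left_module R N by fact
  obtain P d where Pd: "chosen_resolution R T = (P, d)" by fastforce
  obtain \<epsilon> where res: "proj_resolution R T P d \<epsilon>" using chosen_resolution[OF T Pd] by blast
  have PM: "left_module R (P n)" for n using res by (simp add: proj_resolution_def projective_def)
  have d: "d n \<in> mod_hom R (P (Suc n)) (P n)" for n using res by (simp add: proj_resolution_def)
  have dd: "d n (d (Suc n) x) = \<zero>\<^bsub>P n\<^esub>" if "x \<in> carrier (P (Suc (Suc n)))" for n x
  proof -
    have "d (Suc n) x \<in> d (Suc n) ` carrier (P (Suc (Suc n)))" using that by (rule imageI)
    also have "\<dots> = a_kernel (P (Suc n)) (P n) (d n)" using res by (simp add: proj_resolution_def)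
    finally show ?thesis by (simp add: a_kernel_def')
  qed
  let ?G = "\<lambda>n. Hom_group R (P n) N" and ?Z = "cocycles R P d N" and ?B = "coboundaries R P d N"
  have G: "comm_group (?G n)" for n by (rule Hom_comm_group[OF PM N])
  have one: "\<one>\<^bsub>?G n\<^esub> x = \<zero>\<^bsub>N\<^esub>" if "x \<in> carrier (P n)" for n x using that by (simp add: Hom_group_def)
  have mult: "(f \<otimes>\<^bsub>?G n\<^esub> g) x = f x \<oplus>\<^bsub>N\<^esub> g x" if "x \<in> carrier (P n)" for n x f g
    using that by (simp add: Hom_group_def)
  have ext: "f = g" if "f \<in> carrier (?G n)" "g \<in> carrier (?G n)"
    "\<And>x. x \<in> carrier (P n) \<Longrightarrow> f x = g x" for n f g
    using that by (intro extensionalityI[of f "carrier (P n)" g]) (auto simp: Hom_group_def)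
  have Z: "subgroup (?Z i) (?G i)"
  proof -
    interpret G: comm_group "?G i" by (rule G)
    show ?thesis
    proof (rule G.subgroupI)
      show "?Z i \<subseteq> carrier (?G i)" by (auto simp: cocycles_def)
      have "\<one>\<^bsub>?G i\<^esub> \<in> ?Z i" using mod_homD(1)[OF d] by (simp add: cocycles_def one)
      then show "?Z i \<noteq> {}" by blast
    next
      fix f assume "f \<in> ?Z i"
      then have f: "f \<in> carrier (?G i)" "\<And>x. x \<in> carrier (P (Suc i)) \<Longrightarrow> f (d i x) = \<zero>\<^bsub>N\<^esub>"
        by (auto simp: cocycles_def)
      show "inv\<^bsub>?G i\<^esub> f \<in> ?Z i"
        using f mod_homD(1)[OF d] by (simp add: cocycles_def Hom_group_inv[OF PM N])
      fix g assume "g \<in> ?Z i"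
      then show "f \<otimes>\<^bsub>?G i\<^esub> g \<in> ?Z i"
        using f mod_homD(1)[OF d] by (simp add: cocycles_def mult)
    qed
  qed
  have B: "subgroup (?B i) (?G i)" "?B i \<subseteq> ?Z i"
  proof -
    interpret G: comm_group "?G i" by (rule G)
    have "subgroup (?B i) (?G i) \<and> ?B i \<subseteq> ?Z i"
    proof (cases i)
      case 0
      then show ?thesis using G.triv_subgroup subgroup.one_closed[OF Z] by simp
    next
      case (Suc j)
      interpret H: comm_group "?G j" by (rule G)
      let ?c = "\<lambda>g. compose (carrier (P (Suc j))) g (d j)"
      have c: "?c g \<in> carrier (?G i)" if "g \<in> carrier (?G j)" for g
      proof -
        have g: "g \<in> mod_hom R (P j) N" using that by (simp add: Hom_group_def)
        interpret Q: left_module R "P (Suc j)" by (rule PM)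
        have "?c g \<in> mod_hom R (P (Suc j)) N"
          by (rule mod_homI) (simp_all add: compose_eq mod_homD[OF g] mod_homD[OF d])
        then show ?thesis by (simp add: Hom_group_def Suc compose_def)
      qed
      have "group_hom (?G j) (?G i) ?c"
      proof (intro group_hom.intro group_hom_axioms.intro H.group_axioms G.group_axioms homI c)
        fix f g assume f: "f \<in> carrier (?G j)" and g: "g \<in> carrier (?G j)"
        show "?c (f \<otimes>\<^bsub>?G j\<^esub> g) = ?c f \<otimes>\<^bsub>?G i\<^esub> ?c g"
          by (rule ext[of _ i])
            (use f g mod_homD(1)[OF d] in \<open>auto simp: c Suc mult compose_eq
              intro!: c[unfolded Suc] G.m_closed[unfolded Suc]\<close>)
      qed
      then have "subgroup (?c ` carrier (?G j)) (?G i)" by (rule group_hom.img_is_subgroup)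
      moreover have "?c g \<in> ?Z i" if "g \<in> carrier (?G j)" for g
      proof -
        have g: "g \<in> mod_hom R (P j) N" using that by (simp add: Hom_group_def)
        have "?c g (d i x) = \<zero>\<^bsub>N\<^esub>" if "x \<in> carrier (P (Suc i))" for x
          using that mod_homD(1)[OF d, of x "Suc j"] dd[of x j] mod_hom_zero[OF PM N g]
          by (simp add: Suc compose_eq)
        then show ?thesis using c[OF that] by (simp add: cocycles_def)
      qed
      ultimately show ?thesis by (auto simp: Suc)
    qed
    then show "subgroup (?B i) (?G i)" "?B i \<subseteq> ?Z i" by auto
  qed
  interpret G: comm_group "?G i" by (rule G)
  interpret Z: group "?G i\<lparr>carrier := ?Z i\<rparr>" by (rule G.subgroup_imp_group[OF Z])
  have "subgroup (?B i) (?G i\<lparr>carrier := ?Z i\<rparr>)" by (rule G.subgroup_incl[OF B(1) Z B(2)])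
  then have "?B i \<lhd> ?G i\<lparr>carrier := ?Z i\<rparr>"
  proof (rule Z.normalI, intro ballI)
    fix x assume x: "x \<in> carrier (?G i\<lparr>carrier := ?Z i\<rparr>)"
    have "b \<otimes>\<^bsub>?G i\<^esub> x = x \<otimes>\<^bsub>?G i\<^esub> b" if "b \<in> ?B i" for b
      using x that B(2) subgroup.subset[OF Z] by (intro G.m_comm) auto
    then show "?B i #>\<^bsub>?G i\<lparr>carrier := ?Z i\<rparr>\<^esub> x = x <#\<^bsub>?G i\<lparr>carrier := ?Z i\<rparr>\<^esub> ?B i"
      by (auto simp: r_coset_def l_coset_def)
  qed
  then show ?thesis unfolding Ext_def Hom_cohomology_def Pd by (simp add: normal.factorgroup_is_group)
qed

end

theory Submission
  imports Defs
begin

text \<open>Let \<open>M = P/A\<close> and \<open>C = A \<oplus> B\<close>, where \<open>P/C\<close> has grade at least 2. By the Ore condition on both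
  sides, a finitely generated module without nonzero functionals is torsion; as \<open>Hom(P/C, R) = 0\<close>,
  every element of \<open>P\<close> has a nonzero multiple in \<open>C\<close>. As \<open>Ext\<^sup>1(P/C, R) = 0\<close>, functionals on \<open>C\<close>
  extend to \<open>P\<close>, and hence, using coordinates on the finitely generated projective module \<open>P\<close>, the
  projection \<open>C \<rightarrow> A\<close> extends to an endomorphism \<open>e\<close> of \<open>P\<close>. Since \<open>P\<close> is torsion-free, \<open>e\<close> fixes
  the kernel of \<open>P \<rightarrow> M/t(M)\<close> pointwise, and it maps \<open>P\<close> into that kernel. So if \<open>h\<close> lifts along
  some epimorphism a map induced on \<open>P\<close> by a map on \<open>M/t(M)\<close>, then \<open>h \<circ> (1 - e)\<close> lifts it too and
  factors through \<open>M/t(M)\<close>.\<close>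

section \<open>Submodules, quotients and homomorphisms\<close>

lemma submoduleD:
  assumes "submodule H R M"
  shows "H \<subseteq> carrier M" "\<zero>\<^bsub>M\<^esub> \<in> H"
    and "\<lbrakk>x \<in> H; y \<in> H\<rbrakk> \<Longrightarrow> x \<oplus>\<^bsub>M\<^esub> y \<in> H"
    and "\<lbrakk>r \<in> carrier R; x \<in> H\<rbrakk> \<Longrightarrow> r \<odot>\<^bsub>M\<^esub> x \<in> H"
    and "x \<in> H \<Longrightarrow> \<ominus>\<^bsub>M\<^esub> x \<in> H"
proof -
  interpret submodule H R M by fact
  show "H \<subseteq> carrier M" "\<zero>\<^bsub>M\<^esub> \<in> H" using subset one_closed by auto
  show "x \<oplus>\<^bsub>M\<^esub> y \<in> H" if "x \<in> H" "y \<in> H" using m_closed[OF that] by simp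
  show "r \<odot>\<^bsub>M\<^esub> x \<in> H" if "r \<in> carrier R" "x \<in> H" using that by simp
  show "\<ominus>\<^bsub>M\<^esub> x \<in> H" if "x \<in> H" using m_inv_closed[OF that] by (simp add: a_inv_def)
qed

lemma left_module_smult_neg_left:
  assumes "left_module R M" and r: "r \<in> carrier R" and x: "x \<in> carrier M"
  shows "(\<ominus>\<^bsub>R\<^esub> r) \<odot>\<^bsub>M\<^esub> x = \<ominus>\<^bsub>M\<^esub> (r \<odot>\<^bsub>M\<^esub> x)"
proof -
  interpret M: left_module R M by fact
  have "(\<ominus>\<^bsub>R\<^esub> r) \<odot>\<^bsub>M\<^esub> x \<oplus>\<^bsub>M\<^esub> r \<odot>\<^bsub>M\<^esub> x = \<zero>\<^bsub>M\<^esub>"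
    using M.smult_l_distr[of "\<ominus>\<^bsub>R\<^esub> r" r x] r x
    by (simp add: M.R.l_neg left_module_smult_zero[OF assms(1)])
  then show ?thesis using r x by (simp add: M.M.minus_equality)
qed

text \<open>Closure under negation follows from closure under scalars because
  \<open>-x = (-1) x\<close>; this supplies the inverse condition in the subgroup part of
  \<open>submodule\<close>.\<close>

lemma left_submoduleI:
  assumes "left_module R M" and "H \<subseteq> carrier M" and "\<zero>\<^bsub>M\<^esub> \<in> H"
    and add: "\<And>x y. \<lbrakk>x \<in> H; y \<in> H\<rbrakk> \<Longrightarrow> x \<oplus>\<^bsub>M\<^esub> y \<in> H"
    and smult: "\<And>r x. \<lbrakk>r \<in> carrier R; x \<in> H\<rbrakk> \<Longrightarrow> r \<odot>\<^bsub>M\<^esub> x \<in> H"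
  shows "submodule H R M"
proof -
  interpret M: left_module R M by fact
  have "\<ominus>\<^bsub>M\<^esub> x \<in> H" if "x \<in> H" for x
    using smult[of "\<ominus>\<^bsub>R\<^esub> \<one>\<^bsub>R\<^esub>" x] that assms(2)
    by (auto simp: left_module_smult_neg_left[OF assms(1)] subset_iff)
  then show ?thesis
    using assms by (intro submodule.intro submodule_axioms.intro M.M.add.subgroupI)
      (auto simp: a_inv_def)
qed

lemma submodule_carrier:
  assumes "left_module R M"
  shows "submodule (carrier M) R M"
proof -
  interpret M: left_module R M by fact
  show ?thesis by (rule left_submoduleI[OF assms]) simp_all
qed

lemma set_addI: "\<lbrakk>a \<in> A; b \<in> B\<rbrakk> \<Longrightarrow> a \<oplus>\<^bsub>M\<^esub> b \<in> A <+>\<^bsub>M\<^esub> B"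
  by (auto simp: set_add_def')

lemma submodule_sum:
  assumes "left_module R M" "submodule A R M" "submodule B R M"
  shows "submodule (A <+>\<^bsub>M\<^esub> B) R M"
proof -
  interpret M: left_module R M by fact
  note A = submoduleD[OF assms(2)] and B = submoduleD[OF assms(3)]
  have sub: "a \<in> carrier M" if "a \<in> A \<or> a \<in> B" for a using that A(1) B(1) by auto
  show ?thesis
  proof (rule left_submoduleI[OF assms(1)])
    show "A <+>\<^bsub>M\<^esub> B \<subseteq> carrier M" using sub by (auto simp: set_add_def')
    show "\<zero>\<^bsub>M\<^esub> \<in> A <+>\<^bsub>M\<^esub> B" using set_addI[OF A(2) B(2), of M] by simp
  next
    fix x y assume "x \<in> A <+>\<^bsub>M\<^esub> B" "y \<in> A <+>\<^bsub>M\<^esub> B"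
    then obtain a b a' b' where *: "a \<in> A" "b \<in> B" "a' \<in> A" "b' \<in> B"
      "x = a \<oplus>\<^bsub>M\<^esub> b" "y = a' \<oplus>\<^bsub>M\<^esub> b'" by (auto simp: set_add_def')
    then have "x \<oplus>\<^bsub>M\<^esub> y = (a \<oplus>\<^bsub>M\<^esub> a') \<oplus>\<^bsub>M\<^esub> (b \<oplus>\<^bsub>M\<^esub> b')"
      using sub by (simp add: M.M.a_ac)
    then show "x \<oplus>\<^bsub>M\<^esub> y \<in> A <+>\<^bsub>M\<^esub> B"
      using set_addI[OF A(3)[OF *(1,3)] B(3)[OF *(2,4)], of M] by simp
  next
    fix r x assume r: "r \<in> carrier R" and "x \<in> A <+>\<^bsub>M\<^esub> B"
    then obtain a b where *: "a \<in> A" "b \<in> B" "x = a \<oplus>\<^bsub>M\<^esub> b" by (auto simp: set_add_def')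
    then have "r \<odot>\<^bsub>M\<^esub> x = r \<odot>\<^bsub>M\<^esub> a \<oplus>\<^bsub>M\<^esub> r \<odot>\<^bsub>M\<^esub> b" using sub r by (simp add: M.smult_r_distr)
    then show "r \<odot>\<^bsub>M\<^esub> x \<in> A <+>\<^bsub>M\<^esub> B"
      using set_addI[OF A(4)[OF r *(1)] B(4)[OF r *(2)], of M] by simp
  qed
qed

lemma submodule_image:
  assumes "left_module R M" "left_module R N" and f: "f \<in> mod_hom R M N"
  shows "submodule (f ` carrier M) R N"
proof -
  interpret M: left_module R M by fact
  show ?thesis
  proof (rule left_submoduleI[OF assms(2)])
    show "\<zero>\<^bsub>N\<^esub> \<in> f ` carrier M" using mod_hom_zero[OF assms] by (metis M.M.zero_closed imageI)
    show "x \<oplus>\<^bsub>N\<^esub> y \<in> f ` carrier M" if "x \<in> f ` carrier M" "y \<in> f ` carrier M" for x y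
      using that by (auto simp flip: mod_homD(2)[OF f])
    show "r \<odot>\<^bsub>N\<^esub> x \<in> f ` carrier M" if "r \<in> carrier R" "x \<in> f ` carrier M" for r x
      using that by (auto simp flip: mod_homD(3)[OF f])
  qed (auto simp: mod_homD(1)[OF f])
qed

lemma submodule_preimage:
  assumes "left_module R M" "left_module R N" and f: "f \<in> mod_hom R M N" and H: "submodule H R N"
  shows "submodule {x \<in> carrier M. f x \<in> H} R M"
proof -
  interpret M: left_module R M by fact
  show ?thesis
    by (rule left_submoduleI[OF assms(1)])
      (auto simp: mod_homD[OF f] mod_hom_zero[OF assms(1-3)] submoduleD[OF H])
qed

lemma mod_span_superset: "S \<subseteq> mod_span R M S"
  by (auto simp: mod_span_def)

lemma mod_span_least: "\<lbrakk>submodule H R M; S \<subseteq> H\<rbrakk> \<Longrightarrow> mod_span R M S \<subseteq> H"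
  by (auto simp: mod_span_def)

lemma submodule_mod_span:
  assumes "left_module R M" "S \<subseteq> carrier M"
  shows "submodule (mod_span R M S) R M"
proof (rule left_submoduleI[OF assms(1)])
  show "mod_span R M S \<subseteq> carrier M"
    by (rule mod_span_least[OF submodule_carrier[OF assms(1)] assms(2)])
qed (auto simp: mod_span_def submoduleD)

text \<open>The preimage of the span of the image generators is a submodule that contains all
  original generators, so it is the whole of \<open>M\<close>; surjectivity then gives the
  claim.\<close>

lemma fin_gen_image:
  assumes "left_module R M" "left_module R N" and f: "f \<in> mod_hom R M N" "f ` carrier M = carrier N"
    and "fin_gen R M"
  shows "fin_gen R N"
proof -
  obtain S where S: "finite S" "S \<subseteq> carrier M" "mod_span R M S = carrier M"
    using assms(5) by (auto simp: fin_gen_def)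
  have fS: "f ` S \<subseteq> carrier N" using S(2) f(2) by auto
  note H = submodule_mod_span[OF assms(2) fS]
  have "mod_span R M S \<subseteq> {x \<in> carrier M. f x \<in> mod_span R N (f ` S)}"
    by (rule mod_span_least[OF submodule_preimage[OF assms(1,2) f(1) H]])
      (use S(2) mod_span_superset[of "f ` S" R N] in auto)
  then have "carrier N \<subseteq> mod_span R N (f ` S)" unfolding S(3) f(2)[symmetric] by auto
  then show ?thesis
    unfolding fin_gen_def using S(1) fS submoduleD(1)[OF H] by (intro exI[of _ "f ` S"]) auto
qed

section \<open>Arithmetic and construction of homomorphisms\<close>

lemma mod_hom_add:
  assumes "left_module R M" "left_module R N" and f: "f \<in> mod_hom R M N" and g: "g \<in> mod_hom R M N"
  shows "(\<lambda>x. f x \<oplus>\<^bsub>N\<^esub> g x) \<in> mod_hom R M N"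
proof -
  interpret M: left_module R M by fact
  interpret N: left_module R N by fact
  show ?thesis by (rule mod_homI) (simp_all add: mod_homD[OF f] mod_homD[OF g] N.smult_r_distr N.M.a_ac)
qed

lemma mod_hom_diff:
  assumes "left_module R M" "left_module R N" and f: "f \<in> mod_hom R M N" and g: "g \<in> mod_hom R M N"
  shows "(\<lambda>x. f x \<ominus>\<^bsub>N\<^esub> g x) \<in> mod_hom R M N"
proof -
  interpret N: left_module R N by fact
  interpret M: left_module R M by fact
  have "(\<lambda>x. \<ominus>\<^bsub>N\<^esub> g x) \<in> mod_hom R M N"
    by (rule mod_homI)
      (simp_all add: mod_homD[OF g] N.M.minus_add N.M.a_comm left_module_smult_neg[OF assms(2)])
  from mod_hom_add[OF assms(1-3) this] show ?thesis by (simp add: a_minus_def)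
qed

lemma mod_hom_id: "(\<lambda>x. x) \<in> mod_hom R M M"
  by (rule mod_homI) simp_all

lemma mod_hom_subset:
  assumes "f \<in> mod_hom R M N" "H \<subseteq> carrier M"
  shows "f \<in> mod_hom R (M\<lparr>carrier := H\<rparr>) N"
  by (rule mod_homI) (use assms(2) mod_homD[OF assms(1)] in \<open>auto simp: subset_iff\<close>)

lemma mod_hom_neg:
  assumes "left_module R M" "left_module R N" and f: "f \<in> mod_hom R M N" and x: "x \<in> carrier M"
  shows "f (\<ominus>\<^bsub>M\<^esub> x) = \<ominus>\<^bsub>N\<^esub> f x"
proof -
  interpret N: left_module R N by fact
  interpret M: left_module R M by fact
  have "f (\<ominus>\<^bsub>M\<^esub> x) \<oplus>\<^bsub>N\<^esub> f x = \<zero>\<^bsub>N\<^esub>"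
    using mod_homD(2)[OF f, of "\<ominus>\<^bsub>M\<^esub> x" x] x by (simp add: M.M.l_neg mod_hom_zero[OF assms(1-3)])
  then show ?thesis using x by (simp add: mod_homD(1)[OF f] N.M.minus_equality)
qed

lemma mod_hom_minus:
  assumes "left_module R M" "left_module R N" and f: "f \<in> mod_hom R M N"
    and x: "x \<in> carrier M" and y: "y \<in> carrier M"
  shows "f (x \<ominus>\<^bsub>M\<^esub> y) = f x \<ominus>\<^bsub>N\<^esub> f y"
proof -
  interpret M: left_module R M by fact
  show ?thesis unfolding a_minus_def
    using x y by (simp add: mod_homD[OF f] mod_hom_neg[OF assms(1-3)])
qed

lemma (in abelian_group) minus_eq_zero_iff:
  assumes "x \<in> carrier G" "y \<in> carrier G"
  shows "x \<ominus> y = \<zero> \<longleftrightarrow> x = y"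
proof
  assume "x \<ominus> y = \<zero>"
  then have "(x \<oplus> \<ominus> y) \<oplus> y = y" using assms by (simp add: a_minus_def)
  then show "x = y" using assms by (simp add: a_assoc l_neg)
qed (use assms in \<open>simp add: a_minus_def r_neg\<close>)

text \<open>The universal property of a quotient, for an arbitrary epimorphism \<open>q\<close> in
  place of a coset map. It serves for cyclic submodules as images of the ring and for
  \<open>M/t(M)\<close> as an image of \<open>P\<close>.\<close>

lemma mod_hom_factor:
  assumes "left_module R P" "left_module R Q" "left_module R N"
    and q: "q \<in> mod_hom R P Q" "q ` carrier P = carrier Q" and h: "h \<in> mod_hom R P N"
    and ker: "\<And>x. \<lbrakk>x \<in> carrier P; q x = \<zero>\<^bsub>Q\<^esub>\<rbrakk> \<Longrightarrow> h x = \<zero>\<^bsub>N\<^esub>"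
  shows "\<exists>k\<in>mod_hom R Q N. \<forall>x\<in>carrier P. k (q x) = h x"
proof -
  interpret P: left_module R P by fact
  interpret Q: left_module R Q by fact
  interpret N: left_module R N by fact
  \<comment> \<open>The preimage is an arbitrary choice; two preimages of the same element differ by
    an element of the kernel of \<open>q\<close>, on which \<open>h\<close> vanishes.\<close>
  define k where "k y = h (inv_into (carrier P) q y)" for y
  have k: "k (q x) = h x" if x: "x \<in> carrier P" for x
  proof -
    let ?x = "inv_into (carrier P) q (q x)"
    have x': "?x \<in> carrier P" "q ?x = q x"
      using x by (auto intro: inv_into_into f_inv_into_f)
    then have "h (?x \<ominus>\<^bsub>P\<^esub> x) = \<zero>\<^bsub>N\<^esub>"
      using x by (intro ker)
        (simp_all add: mod_hom_minus[OF assms(1,2) q(1)] Q.M.minus_eq_zero_iff mod_homD(1)[OF q(1)])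
    then show ?thesis unfolding k_def
      using x x' by (simp add: mod_hom_minus[OF assms(1,3) h] N.M.minus_eq_zero_iff mod_homD(1)[OF h])
  qed
  have "k \<in> mod_hom R Q N"
  proof (rule mod_homI)
    fix y assume "y \<in> carrier Q"
    then obtain x where x: "x \<in> carrier P" "y = q x" unfolding q(2)[symmetric] by auto
    then show "k y \<in> carrier N" by (simp add: k mod_homD(1)[OF h])
    show "k (r \<odot>\<^bsub>Q\<^esub> y) = r \<odot>\<^bsub>N\<^esub> k y" if "r \<in> carrier R" for r
      using x that k[of "r \<odot>\<^bsub>P\<^esub> x"] by (simp add: k mod_homD(3)[OF h] mod_homD(3)[OF q(1)])
    fix z assume "z \<in> carrier Q"
    then obtain x' where x': "x' \<in> carrier P" "z = q x'" unfolding q(2)[symmetric] by auto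
    then show "k (y \<oplus>\<^bsub>Q\<^esub> z) = k y \<oplus>\<^bsub>N\<^esub> k z"
      using x k[of "x \<oplus>\<^bsub>P\<^esub> x'"] by (simp add: k mod_homD(2)[OF h] mod_homD(2)[OF q(1)])
  qed
  with k show ?thesis by blast
qed

text \<open>Two decompositions of the same element differ by shifting an element of the intersection
  of \<open>A\<close> and \<open>B\<close> from one summand to the other. Since \<open>g\<close> and
  \<open>k\<close> agree there, \<open>g a + k b\<close> depends only on the sum.\<close>

lemma mod_hom_glue:
  assumes "left_module R M" "left_module R N" and A: "submodule A R M" and B: "submodule B R M"
    and g: "g \<in> mod_hom R (M\<lparr>carrier := A\<rparr>) N" and k: "k \<in> mod_hom R (M\<lparr>carrier := B\<rparr>) N"
    and eq: "\<And>x. \<lbrakk>x \<in> A; x \<in> B\<rbrakk> \<Longrightarrow> g x = k x"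
  shows "\<exists>f\<in>mod_hom R (M\<lparr>carrier := A <+>\<^bsub>M\<^esub> B\<rparr>) N.
    \<forall>a\<in>A. \<forall>b\<in>B. f (a \<oplus>\<^bsub>M\<^esub> b) = g a \<oplus>\<^bsub>N\<^esub> k b"
proof -
  interpret M: left_module R M by fact
  interpret N: left_module R N by fact
  note A' = submoduleD[OF A] and B' = submoduleD[OF B]
  have sub: "a \<in> carrier M" if "a \<in> A \<or> a \<in> B" for a using that A'(1) B'(1) by auto
  note MA = left_module_subset[OF assms(1) A] and MB = left_module_subset[OF assms(1) B]
  have gA: "a \<in> A \<Longrightarrow> g a \<in> carrier N" for a using mod_homD(1)[OF g] by simp
  have kB: "b \<in> B \<Longrightarrow> k b \<in> carrier N" for b using mod_homD(1)[OF k] by simp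
  have gadd: "\<lbrakk>a \<in> A; a' \<in> A\<rbrakk> \<Longrightarrow> g (a \<oplus>\<^bsub>M\<^esub> a') = g a \<oplus>\<^bsub>N\<^esub> g a'" for a a' using mod_homD(2)[OF g] by simp
  have kadd: "\<lbrakk>a \<in> B; a' \<in> B\<rbrakk> \<Longrightarrow> k (a \<oplus>\<^bsub>M\<^esub> a') = k a \<oplus>\<^bsub>N\<^esub> k a'" for a a' using mod_homD(2)[OF k] by simp
  have gs: "\<lbrakk>r \<in> carrier R; a \<in> A\<rbrakk> \<Longrightarrow> g (r \<odot>\<^bsub>M\<^esub> a) = r \<odot>\<^bsub>N\<^esub> g a" for r a using mod_homD(3)[OF g] by simp
  have ks: "\<lbrakk>r \<in> carrier R; a \<in> B\<rbrakk> \<Longrightarrow> k (r \<odot>\<^bsub>M\<^esub> a) = r \<odot>\<^bsub>N\<^esub> k a" for r a using mod_homD(3)[OF k] by simp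
  have wd: "g a \<oplus>\<^bsub>N\<^esub> k b = g a' \<oplus>\<^bsub>N\<^esub> k b'"
    if *: "a \<in> A" "a' \<in> A" "b \<in> B" "b' \<in> B" and e: "a \<oplus>\<^bsub>M\<^esub> b = a' \<oplus>\<^bsub>M\<^esub> b'" for a a' b b'
  proof -
    \<comment> \<open>The shifted element: it equals \<open>a - a'\<close> and also
      \<open>b' - b\<close>, so it lies in both submodules.\<close>
    define d where "d = \<ominus>\<^bsub>M\<^esub> a' \<oplus>\<^bsub>M\<^esub> a"
    have "d \<oplus>\<^bsub>M\<^esub> b = \<ominus>\<^bsub>M\<^esub> a' \<oplus>\<^bsub>M\<^esub> (a \<oplus>\<^bsub>M\<^esub> b)"
      using * sub by (simp add: d_def M.M.a_assoc)
    also have "\<dots> = b'" unfolding e using * sub by (simp add: M.M.a_assoc[symmetric] M.M.l_neg)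
    finally have b': "b' = d \<oplus>\<^bsub>M\<^esub> b" ..
    have d1: "d \<in> A" unfolding d_def using * A' by auto
    have "d = b' \<oplus>\<^bsub>M\<^esub> \<ominus>\<^bsub>M\<^esub> b" unfolding b' using * d1 sub by (simp add: M.M.a_assoc M.M.r_neg)
    then have d2: "d \<in> B" using * B' by auto
    have a: "a = a' \<oplus>\<^bsub>M\<^esub> d" using * sub by (simp add: d_def M.M.a_assoc[symmetric] M.M.r_neg)
    show ?thesis unfolding b' a
      using * d1 d2 by (simp add: gadd kadd eq[OF d1 d2] gA kB N.M.a_assoc)
  qed
  \<comment> \<open>By \<open>wd\<close> the selected value is unique on the sum of \<open>A\<close>
    and \<open>B\<close>; elsewhere it is arbitrary.\<close>
  define f where "f z = (SOME w. \<exists>a\<in>A. \<exists>b\<in>B. z = a \<oplus>\<^bsub>M\<^esub> b \<and> w = g a \<oplus>\<^bsub>N\<^esub> k b)" for z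
  have f: "f (a \<oplus>\<^bsub>M\<^esub> b) = g a \<oplus>\<^bsub>N\<^esub> k b" if "a \<in> A" "b \<in> B" for a b
  proof -
    have "\<exists>w. \<exists>a'\<in>A. \<exists>b'\<in>B. a \<oplus>\<^bsub>M\<^esub> b = a' \<oplus>\<^bsub>M\<^esub> b' \<and> w = g a' \<oplus>\<^bsub>N\<^esub> k b'" using that by blast
    from someI_ex[OF this] obtain a' b' where "a' \<in> A" "b' \<in> B"
      "a \<oplus>\<^bsub>M\<^esub> b = a' \<oplus>\<^bsub>M\<^esub> b'" "f (a \<oplus>\<^bsub>M\<^esub> b) = g a' \<oplus>\<^bsub>N\<^esub> k b'" unfolding f_def by blast
    then show ?thesis using wd[of a a' b b'] that by simp
  qed
  have "f \<in> mod_hom R (M\<lparr>carrier := A <+>\<^bsub>M\<^esub> B\<rparr>) N"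
  proof (rule mod_homI)
    fix x assume "x \<in> carrier (M\<lparr>carrier := A <+>\<^bsub>M\<^esub> B\<rparr>)"
    then obtain a b where ab: "a \<in> A" "b \<in> B" "x = a \<oplus>\<^bsub>M\<^esub> b" by (auto simp: set_add_def')
    then show "f x \<in> carrier N" by (simp add: f gA kB)
    show "f (r \<odot>\<^bsub>M\<lparr>carrier := A <+>\<^bsub>M\<^esub> B\<rparr>\<^esub> x) = r \<odot>\<^bsub>N\<^esub> f x" if r: "r \<in> carrier R" for r
    proof -
      have "f (r \<odot>\<^bsub>M\<^esub> x) = f (r \<odot>\<^bsub>M\<^esub> a \<oplus>\<^bsub>M\<^esub> r \<odot>\<^bsub>M\<^esub> b)" using ab r sub by (simp add: M.smult_r_distr)
      also have "\<dots> = r \<odot>\<^bsub>N\<^esub> f x" using ab r A'(4) B'(4) by (simp add: f gs ks gA kB N.smult_r_distr)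
      finally show ?thesis by simp
    qed
    fix y assume "y \<in> carrier (M\<lparr>carrier := A <+>\<^bsub>M\<^esub> B\<rparr>)"
    then obtain c d where cd: "c \<in> A" "d \<in> B" "y = c \<oplus>\<^bsub>M\<^esub> d" by (auto simp: set_add_def')
    have "f (x \<oplus>\<^bsub>M\<^esub> y) = f ((a \<oplus>\<^bsub>M\<^esub> c) \<oplus>\<^bsub>M\<^esub> (b \<oplus>\<^bsub>M\<^esub> d))"
      using ab cd sub by (simp add: M.M.a_ac)
    also have "\<dots> = f x \<oplus>\<^bsub>N\<^esub> f y" using ab cd A'(3) B'(3) by (simp add: f gadd kadd gA kB N.M.a_ac)
    finally show "f (x \<oplus>\<^bsub>M\<lparr>carrier := A <+>\<^bsub>M\<^esub> B\<rparr>\<^esub> y) = f x \<oplus>\<^bsub>N\<^esub> f y" by simp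
  qed
  then show ?thesis using f by blast
qed

lemma
  assumes "left_module R M" and H: "submodule H R M"
  shows left_module_quot: "left_module R (quot_module R M H)"
    and quot_hom: "(\<lambda>x. H +>\<^bsub>M\<^esub> x) \<in> mod_hom R M (quot_module R M H)"
    and quot_surj: "(\<lambda>x. H +>\<^bsub>M\<^esub> x) ` carrier M = carrier (quot_module R M H)"
    and quot_eq_zero_iff: "x \<in> carrier M \<Longrightarrow> H +>\<^bsub>M\<^esub> x = \<zero>\<^bsub>quot_module R M H\<^esub> \<longleftrightarrow> x \<in> H"
proof -
  interpret M: left_module R M by fact
  interpret H: abelian_subgroup H M
    by (intro abelian_subgroupI3 additive_subgroup.intro submodule.axioms(1)[OF H] M.M.abelian_group_axioms)
  note H' = submoduleD[OF H]
  let ?q = "\<lambda>x. H +>\<^bsub>M\<^esub> x" and ?Q = "quot_module R M H"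
  show iff: "H +>\<^bsub>M\<^esub> x = \<zero>\<^bsub>?Q\<^esub> \<longleftrightarrow> x \<in> H" if "x \<in> carrier M" for x
    using H.a_rcos_self[OF that] H.a_rcos_const[of x] by (auto simp: quot_module_def)
  show surj: "?q ` carrier M = carrier ?Q" by (auto simp: quot_module_def A_RCOSETS_def')
  have zero: "\<zero>\<^bsub>?Q\<^esub> = ?q \<zero>\<^bsub>M\<^esub>" using H.a_rcos_const[OF H'(2)] by (simp add: quot_module_def)
  have add: "?q x \<oplus>\<^bsub>?Q\<^esub> ?q y = ?q (x \<oplus>\<^bsub>M\<^esub> y)" if "x \<in> carrier M" "y \<in> carrier M" for x y
    using H.a_rcos_sum[OF that] by (simp add: quot_module_def)
  have smult: "r \<odot>\<^bsub>?Q\<^esub> ?q x = ?q (r \<odot>\<^bsub>M\<^esub> x)" if r: "r \<in> carrier R" and x: "x \<in> carrier M" for r x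
  proof -
    \<comment> \<open>\<open>quot_module\<close> takes a union over all representatives of a coset.
      All members of that union are the same coset, so the union collapses to it.\<close>
    have *: "?q (r \<odot>\<^bsub>M\<^esub> y) = ?q (r \<odot>\<^bsub>M\<^esub> x)" if y: "y \<in> ?q x" for y
    proof -
      obtain h where h: "h \<in> H" "y = h \<oplus>\<^bsub>M\<^esub> x" using y by (auto simp: a_r_coset_def')
      then have "r \<odot>\<^bsub>M\<^esub> y = r \<odot>\<^bsub>M\<^esub> h \<oplus>\<^bsub>M\<^esub> r \<odot>\<^bsub>M\<^esub> x"
        using r x H'(1) by (auto simp: M.smult_r_distr)
      moreover have "r \<odot>\<^bsub>M\<^esub> h \<in> H" using h r H'(4) by simp
      ultimately have "r \<odot>\<^bsub>M\<^esub> y \<in> ?q (r \<odot>\<^bsub>M\<^esub> x)" by (auto simp: a_r_coset_def')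
      then show ?thesis using H.a_repr_independence'[of "r \<odot>\<^bsub>M\<^esub> y" "r \<odot>\<^bsub>M\<^esub> x"] r x by simp
    qed
    have "x \<in> ?q x" by (rule H.a_rcos_self[OF x])
    with * have "(\<Union>y\<in>?q x. ?q (r \<odot>\<^bsub>M\<^esub> y)) = ?q (r \<odot>\<^bsub>M\<^esub> x)" by blast
    then show ?thesis by (simp add: quot_module_def)
  qed
  have cl: "?q x \<in> carrier ?Q" if "x \<in> carrier M" for x using that surj by blast
  have ex: "\<exists>x\<in>carrier M. X = ?q x" if "X \<in> carrier ?Q" for X using that surj by blast
  show "?q \<in> mod_hom R M ?Q" by (rule mod_homI) (simp_all add: cl add smult)
  have "abelian_group ?Q"
  proof (rule abelian_groupI)
    show "\<zero>\<^bsub>?Q\<^esub> \<in> carrier ?Q" by (simp add: zero cl)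
  next
    fix X assume "X \<in> carrier ?Q"
    then obtain x where x: "x \<in> carrier M" "X = ?q x" using ex by blast
    then show "\<zero>\<^bsub>?Q\<^esub> \<oplus>\<^bsub>?Q\<^esub> X = X" by (simp add: zero add)
    show "\<exists>Y\<in>carrier ?Q. Y \<oplus>\<^bsub>?Q\<^esub> X = \<zero>\<^bsub>?Q\<^esub>"
      using x by (intro bexI[of _ "?q (\<ominus>\<^bsub>M\<^esub> x)"]) (simp_all add: add zero cl M.M.l_neg)
    fix Y assume "Y \<in> carrier ?Q"
    then obtain y where y: "y \<in> carrier M" "Y = ?q y" using ex by blast
    show "X \<oplus>\<^bsub>?Q\<^esub> Y \<in> carrier ?Q" "X \<oplus>\<^bsub>?Q\<^esub> Y = Y \<oplus>\<^bsub>?Q\<^esub> X"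
      using x y by (simp_all add: add cl M.M.a_comm)
    fix Z assume "Z \<in> carrier ?Q"
    then obtain z where z: "z \<in> carrier M" "Z = ?q z" using ex by blast
    show "X \<oplus>\<^bsub>?Q\<^esub> Y \<oplus>\<^bsub>?Q\<^esub> Z = X \<oplus>\<^bsub>?Q\<^esub> (Y \<oplus>\<^bsub>?Q\<^esub> Z)"
      using x y z by (simp add: add M.M.a_assoc)
  qed
  then show "left_module R ?Q"
  proof (intro left_module.intro left_module_axioms.intro M.R.ring_axioms)
    fix a X assume a: "a \<in> carrier R" and "X \<in> carrier ?Q"
    then obtain x where x: "x \<in> carrier M" "X = ?q x" using ex by blast
    show "a \<odot>\<^bsub>?Q\<^esub> X \<in> carrier ?Q" using a x by (simp add: smult cl)
    show "(a \<oplus>\<^bsub>R\<^esub> b) \<odot>\<^bsub>?Q\<^esub> X = a \<odot>\<^bsub>?Q\<^esub> X \<oplus>\<^bsub>?Q\<^esub> b \<odot>\<^bsub>?Q\<^esub> X"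
      "(a \<otimes>\<^bsub>R\<^esub> b) \<odot>\<^bsub>?Q\<^esub> X = a \<odot>\<^bsub>?Q\<^esub> (b \<odot>\<^bsub>?Q\<^esub> X)" if "b \<in> carrier R" for b
      using a x that by (simp_all add: smult add M.smult_l_distr M.smult_assoc1)
    fix Y assume "Y \<in> carrier ?Q"
    then obtain y where y: "y \<in> carrier M" "Y = ?q y" using ex by blast
    show "a \<odot>\<^bsub>?Q\<^esub> (X \<oplus>\<^bsub>?Q\<^esub> Y) = a \<odot>\<^bsub>?Q\<^esub> X \<oplus>\<^bsub>?Q\<^esub> a \<odot>\<^bsub>?Q\<^esub> Y"
      using a x y by (simp add: smult add M.smult_r_distr)
  next
    fix X assume "X \<in> carrier ?Q"
    then obtain x where "x \<in> carrier M" "X = ?q x" using ex by blast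
    then show "\<one>\<^bsub>R\<^esub> \<odot>\<^bsub>?Q\<^esub> X = X" by (simp add: smult)
  qed
qed

section \<open>The ring as a left module over itself\<close>

lemma regular_module_simps [simp]:
  "carrier (regular_module R) = carrier R" "\<zero>\<^bsub>regular_module R\<^esub> = \<zero>\<^bsub>R\<^esub>"
  "x \<oplus>\<^bsub>regular_module R\<^esub> y = x \<oplus>\<^bsub>R\<^esub> y" "r \<odot>\<^bsub>regular_module R\<^esub> x = r \<otimes>\<^bsub>R\<^esub> x"
  by (simp_all add: regular_module_def)

lemma left_module_regular:
  assumes "ring R"
  shows "left_module R (regular_module R)"
proof -
  interpret ring R by fact
  have "abelian_group (regular_module R)"
    by (rule abelian_groupI) (auto simp: a_ac intro: l_neg)
  then show ?thesis
    by (intro left_module.intro left_module_axioms.intro assms) (auto simp: l_distr r_distr m_assoc)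
qed

text \<open>The image of this map is the cyclic submodule \<open>R x\<close>; for the regular module
  the map is right multiplication by \<open>x\<close>.\<close>

lemma mod_hom_smult_elt:
  assumes "left_module R M" and x: "x \<in> carrier M"
  shows "(\<lambda>r. r \<odot>\<^bsub>M\<^esub> x) \<in> mod_hom R (regular_module R) M"
proof -
  interpret M: left_module R M by fact
  show ?thesis using x by (intro mod_homI) (simp_all add: M.smult_l_distr M.smult_assoc1)
qed

section \<open>The Ore condition\<close>

text \<open>In this form the condition says that \<open>R/R b\<close> is a torsion module for every
  nonzero \<open>b\<close>. Only \<open>r\<close> has to be nonzero, so \<open>a = 0\<close> is
  covered with \<open>s = 0\<close>.\<close>

definition left_ore :: "('r, 'x) ring_scheme \<Rightarrow> bool"
  where "left_ore R \<longleftrightarrow> (\<forall>a\<in>carrier R. \<forall>b\<in>carrier R - {\<zero>\<^bsub>R\<^esub>}.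
    \<exists>r\<in>carrier R - {\<zero>\<^bsub>R\<^esub>}. \<exists>s\<in>carrier R. r \<otimes>\<^bsub>R\<^esub> a = s \<otimes>\<^bsub>R\<^esub> b)"

lemma nc_domainD:
  assumes "nc_domain R"
  shows "ring R" "\<one>\<^bsub>R\<^esub> \<noteq> \<zero>\<^bsub>R\<^esub>"
    and "\<lbrakk>a \<in> carrier R; b \<in> carrier R; a \<otimes>\<^bsub>R\<^esub> b = \<zero>\<^bsub>R\<^esub>\<rbrakk> \<Longrightarrow> a = \<zero>\<^bsub>R\<^esub> \<or> b = \<zero>\<^bsub>R\<^esub>"
  using assms by (auto simp: nc_domain_def)

text \<open>If \<open>R a\<close> and \<open>R b\<close> met only in zero, the ideals \<open>J k = R b + R b a + \<dots> + R b a\<^sup>k\<close> would be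
  strictly increasing.\<close>

lemma noetherian_imp_left_ore:
  assumes dom: "nc_domain R" and noeth: "left_noetherian R"
  shows "left_ore R"
proof (rule ccontr)
  interpret R: ring R by (rule nc_domainD(1)[OF dom])
  let ?RM = "regular_module R"
  note RM = left_module_regular[OF R.ring_axioms]
  assume "\<not> left_ore R"
  then obtain a b where a: "a \<in> carrier R" and b: "b \<in> carrier R" "b \<noteq> \<zero>\<^bsub>R\<^esub>"
    and no: "\<And>r s. \<lbrakk>r \<in> carrier R; s \<in> carrier R; r \<otimes>\<^bsub>R\<^esub> a = s \<otimes>\<^bsub>R\<^esub> b\<rbrakk> \<Longrightarrow> r = \<zero>\<^bsub>R\<^esub>"
    unfolding left_ore_def by blast
  \<comment> \<open>The sum of the \<open>R b a^i\<close> in Horner form: multiply the previous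
    ideal by \<open>a\<close> on the right and add \<open>R b\<close>.\<close>
  define J where "J = rec_nat {s \<otimes>\<^bsub>R\<^esub> b |s. s \<in> carrier R}
    (\<lambda>_ H. {s \<otimes>\<^bsub>R\<^esub> b \<oplus>\<^bsub>R\<^esub> y \<otimes>\<^bsub>R\<^esub> a |s y. s \<in> carrier R \<and> y \<in> H})"
  have J0: "J 0 = {s \<otimes>\<^bsub>R\<^esub> b |s. s \<in> carrier R}"
    and JS: "J (Suc k) = {s \<otimes>\<^bsub>R\<^esub> b \<oplus>\<^bsub>R\<^esub> y \<otimes>\<^bsub>R\<^esub> a |s y. s \<in> carrier R \<and> y \<in> J k}" for k
    by (simp_all add: J_def)
  have sub: "submodule (J k) R ?RM" for k
  proof (induction k)
    case 0
    have "J 0 = (\<lambda>r. r \<odot>\<^bsub>?RM\<^esub> b) ` carrier ?RM" unfolding J0 by auto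
    then show ?case using submodule_image[OF RM RM mod_hom_smult_elt[OF RM]] b(1) by simp
  next
    case (Suc k)
    have b': "b \<in> carrier ?RM" and a': "a \<in> carrier ?RM" using a b by simp_all
    have "J (Suc k) = (\<lambda>r. r \<odot>\<^bsub>?RM\<^esub> b) ` carrier ?RM
        <+>\<^bsub>?RM\<^esub> (\<lambda>r. r \<odot>\<^bsub>?RM\<^esub> a) ` carrier (?RM\<lparr>carrier := J k\<rparr>)"
      unfolding JS by (auto simp: set_add_def')
    moreover have "(\<lambda>r. r \<odot>\<^bsub>?RM\<^esub> a) \<in> mod_hom R (?RM\<lparr>carrier := J k\<rparr>) ?RM"
      by (rule mod_hom_subset[OF mod_hom_smult_elt[OF RM a'] submoduleD(1)[OF Suc]])
    ultimately show ?case
      using submodule_sum[OF RM submodule_image[OF RM RM mod_hom_smult_elt[OF RM b']]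
          submodule_image[OF left_module_subset[OF RM Suc] RM]] by simp
  qed
  have Jcl: "y \<in> carrier R" if "y \<in> J k" for y k using submoduleD(1)[OF sub[of k]] that by auto
  have step: "J k \<subseteq> J (Suc k)" for k
  proof (induction k)
    case 0
    have "s \<otimes>\<^bsub>R\<^esub> b \<in> J (Suc 0)" if s: "s \<in> carrier R" for s
    proof -
      have "s \<otimes>\<^bsub>R\<^esub> b = s \<otimes>\<^bsub>R\<^esub> b \<oplus>\<^bsub>R\<^esub> \<zero>\<^bsub>R\<^esub> \<otimes>\<^bsub>R\<^esub> a" using s a b by simp
      moreover have "\<zero>\<^bsub>R\<^esub> \<in> J 0" using submoduleD(2)[OF sub[of 0]] by simp
      ultimately show ?thesis unfolding JS using s by blast
    qed
    then show ?case unfolding J0 by blast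
  next
    case (Suc k)
    then show ?case unfolding JS[of k] JS[of "Suc k"] by blast
  qed
  have mono: "J i \<subseteq> J j" if "i \<le> j" for i j using that step by (rule lift_Suc_mono_le[rotated])
  \<comment> \<open>The union of the chain is a left ideal, hence finitely generated. Its generators
    lie in a single \<open>J k\<close>, so the chain stops growing there.\<close>
  have "submodule (\<Union>k. J k) R ?RM"
  proof (rule left_submoduleI[OF RM])
    show "(\<Union>k. J k) \<subseteq> carrier ?RM" using Jcl by auto
    show "\<zero>\<^bsub>?RM\<^esub> \<in> (\<Union>k. J k)" using submoduleD(2)[OF sub] by blast
    show "x \<oplus>\<^bsub>?RM\<^esub> y \<in> (\<Union>k. J k)" if xy: "x \<in> (\<Union>k. J k)" "y \<in> (\<Union>k. J k)" for x y
    proof -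
      obtain i j where "x \<in> J i" "y \<in> J j" using xy by blast
      then have "x \<in> J (max i j)" "y \<in> J (max i j)"
        using mono[of i "max i j"] mono[of j "max i j"] by auto
      then show ?thesis using submoduleD(3)[OF sub] by blast
    qed
    show "r \<odot>\<^bsub>?RM\<^esub> x \<in> (\<Union>k. J k)" if "r \<in> carrier R" "x \<in> (\<Union>k. J k)" for r x
      using that submoduleD(4)[OF sub] by blast
  qed
  then obtain S where S: "finite S" "S \<subseteq> (\<Union>k. J k)" "mod_span R ?RM S = (\<Union>k. J k)"
    using noeth unfolding left_noetherian_def by blast
  have "\<exists>k. S \<subseteq> J k"
    using S(1,2)
  proof (induction S)
    case (insert x S)
    then obtain i j where "S \<subseteq> J i" "x \<in> J j" by auto
    then have "insert x S \<subseteq> J (max i j)" using mono[of i "max i j"] mono[of j "max i j"] by auto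
    then show ?case by blast
  qed simp
  then obtain k where "S \<subseteq> J k" by blast
  then have "(\<Union>k. J k) \<subseteq> J k" unfolding S(3)[symmetric] by (rule mod_span_least[OF sub])
  then have "J (Suc k) \<subseteq> J k" by blast
  \<comment> \<open>Strictness by induction. At the start, \<open>b a = s b\<close> would force
    \<open>b = 0\<close>; afterwards, an inclusion at one level would imply the inclusion one level
    below.\<close>
  moreover have "\<not> J (Suc k) \<subseteq> J k" for k
  proof (induction k)
    case 0
    show ?case
    proof
      assume *: "J (Suc 0) \<subseteq> J 0"
      have "b = \<one>\<^bsub>R\<^esub> \<otimes>\<^bsub>R\<^esub> b" using b by simp
      then have "b \<in> J 0" unfolding J0 by blast
      then have "\<zero>\<^bsub>R\<^esub> \<otimes>\<^bsub>R\<^esub> b \<oplus>\<^bsub>R\<^esub> b \<otimes>\<^bsub>R\<^esub> a \<in> J (Suc 0)" unfolding JS by blast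
      then have "b \<otimes>\<^bsub>R\<^esub> a \<in> J 0" using * a b by auto
      then obtain s where "s \<in> carrier R" "b \<otimes>\<^bsub>R\<^esub> a = s \<otimes>\<^bsub>R\<^esub> b" unfolding J0 by blast
      then show False using no b by blast
    qed
  next
    case (Suc k)
    have "J (Suc k) \<subseteq> J k" if *: "J (Suc (Suc k)) \<subseteq> J (Suc k)"
    proof
      fix y assume y: "y \<in> J (Suc k)"
      then have "\<zero>\<^bsub>R\<^esub> \<otimes>\<^bsub>R\<^esub> b \<oplus>\<^bsub>R\<^esub> y \<otimes>\<^bsub>R\<^esub> a \<in> J (Suc (Suc k))" unfolding JS[of "Suc k"] by blast
      then have "y \<otimes>\<^bsub>R\<^esub> a \<in> J (Suc k)" using * a b Jcl[OF y] by auto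
      then obtain s y' where s: "s \<in> carrier R" "y' \<in> J k" "y \<otimes>\<^bsub>R\<^esub> a = s \<otimes>\<^bsub>R\<^esub> b \<oplus>\<^bsub>R\<^esub> y' \<otimes>\<^bsub>R\<^esub> a"
        unfolding JS[of k] by blast
      note cl = Jcl[OF y] Jcl[OF s(2)]
      \<comment> \<open>The difference \<open>y - y'\<close> takes \<open>a\<close> into
        \<open>R b\<close>, and \<open>no\<close> allows this only for zero.\<close>
      have "(y \<ominus>\<^bsub>R\<^esub> y') \<otimes>\<^bsub>R\<^esub> a = s \<otimes>\<^bsub>R\<^esub> b"
        using s cl a b by (simp add: a_minus_def R.l_distr R.l_minus R.a_assoc R.r_neg)
      then have "y \<ominus>\<^bsub>R\<^esub> y' = \<zero>\<^bsub>R\<^esub>" using no s(1) cl by simp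
      then have "y = y'" using cl by (simp add: R.minus_eq_zero_iff)
      then show "y \<in> J k" using s(2) by simp
    qed
    then show ?case using Suc by blast
  qed
  ultimately show False by blast
qed

lemma nc_domain_opposite:
  assumes "nc_domain R" "ring (opposite_ring R)"
  shows "nc_domain (opposite_ring R)"
  using assms by (auto simp: nc_domain_def opposite_ring_def)

text \<open>The right Ore condition is the left one for the opposite ring, which is again a domain;
  that it is a ring is part of \<open>left_noetherian\<close>.\<close>

lemma two_sided_noetherian_ore:
  assumes "nc_domain R" "two_sided_noetherian R"
  shows "left_ore R" "left_ore (opposite_ring R)"
  using assms noetherian_imp_left_ore[of R] noetherian_imp_left_ore[of "opposite_ring R"]
    nc_domain_opposite[of R]
  by (auto simp: two_sided_noetherian_def left_noetherian_def)

lemma left_oreD: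
  assumes "left_ore R" "a \<in> carrier R" "b \<in> carrier R" "b \<noteq> \<zero>\<^bsub>R\<^esub>"
  shows "\<exists>r\<in>carrier R. \<exists>s\<in>carrier R. r \<noteq> \<zero>\<^bsub>R\<^esub> \<and> r \<otimes>\<^bsub>R\<^esub> a = s \<otimes>\<^bsub>R\<^esub> b"
  using assms(1)[unfolded left_ore_def, THEN bspec, OF assms(2), THEN bspec, of b] assms(3,4) by auto

lemma right_oreD:
  assumes "left_ore (opposite_ring R)" "a \<in> carrier R" "b \<in> carrier R" "b \<noteq> \<zero>\<^bsub>R\<^esub>"
  shows "\<exists>r\<in>carrier R. \<exists>s\<in>carrier R. r \<noteq> \<zero>\<^bsub>R\<^esub> \<and> a \<otimes>\<^bsub>R\<^esub> r = b \<otimes>\<^bsub>R\<^esub> s"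
  using left_oreD[OF assms(1), of a b] assms(2-4) by (simp add: opposite_ring_def)

section \<open>Torsion\<close>

lemma torsionI:
  "\<lbrakk>x \<in> carrier M; r \<in> carrier R; r \<noteq> \<zero>\<^bsub>R\<^esub>; r \<odot>\<^bsub>M\<^esub> x = \<zero>\<^bsub>M\<^esub>\<rbrakk> \<Longrightarrow> x \<in> torsion R M"
  by (auto simp: torsion_def)

lemma torsionE:
  assumes "x \<in> torsion R M"
  obtains r where "x \<in> carrier M" "r \<in> carrier R" "r \<noteq> \<zero>\<^bsub>R\<^esub>" "r \<odot>\<^bsub>M\<^esub> x = \<zero>\<^bsub>M\<^esub>"
  using assms by (auto simp: torsion_def)

text \<open>If \<open>s\<close> is nonzero and kills \<open>r x\<close>, then \<open>s r\<close>
  kills \<open>x\<close>, and it is nonzero in a domain.\<close>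

lemma torsion_of_smult:
  assumes "nc_domain R" "left_module R M" "x \<in> carrier M" "r \<in> carrier R" "r \<noteq> \<zero>\<^bsub>R\<^esub>"
    and "r \<odot>\<^bsub>M\<^esub> x \<in> torsion R M"
  shows "x \<in> torsion R M"
proof -
  interpret M: left_module R M by fact
  from assms(6) obtain s where s: "s \<in> carrier R" "s \<noteq> \<zero>\<^bsub>R\<^esub>" "s \<odot>\<^bsub>M\<^esub> (r \<odot>\<^bsub>M\<^esub> x) = \<zero>\<^bsub>M\<^esub>"
    by (rule torsionE)
  show ?thesis
    by (rule torsionI[of _ _ "s \<otimes>\<^bsub>R\<^esub> r"]) (use s assms nc_domainD(3)[OF assms(1)] in \<open>auto simp: M.smult_assoc1\<close>)
qed

lemma submodule_torsion:
  assumes dom: "nc_domain R" and ore: "left_ore R" and M: "left_module R M"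
  shows "submodule (torsion R M) R M"
proof -
  interpret M: left_module R M by fact
  note one = nc_domainD(2)[OF dom]
  have smult: "r \<odot>\<^bsub>M\<^esub> x \<in> torsion R M" if r: "r \<in> carrier R" and "x \<in> torsion R M" for r x
  proof -
    from that(2) obtain s where s: "x \<in> carrier M" "s \<in> carrier R" "s \<noteq> \<zero>\<^bsub>R\<^esub>" "s \<odot>\<^bsub>M\<^esub> x = \<zero>\<^bsub>M\<^esub>"
      by (rule torsionE)
    \<comment> \<open>The Ore condition moves the annihilator \<open>s\<close> of \<open>x\<close>
      past \<open>r\<close>: from \<open>t r = u s\<close> it follows that \<open>t\<close> kills
      \<open>r x\<close>.\<close>
    obtain t u where t: "t \<in> carrier R" "u \<in> carrier R" "t \<noteq> \<zero>\<^bsub>R\<^esub>" "t \<otimes>\<^bsub>R\<^esub> r = u \<otimes>\<^bsub>R\<^esub> s"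
      using left_oreD[OF ore r s(2,3)] by blast
    have "t \<odot>\<^bsub>M\<^esub> (r \<odot>\<^bsub>M\<^esub> x) = (t \<otimes>\<^bsub>R\<^esub> r) \<odot>\<^bsub>M\<^esub> x"
      by (rule M.smult_assoc1[symmetric]) (use t r s in auto)
    also have "\<dots> = \<zero>\<^bsub>M\<^esub>"
      unfolding t(4) using t(2) s by (simp add: M.smult_assoc1 left_module_smult_zero_right[OF M])
    finally show ?thesis using r s t by (intro torsionI[of _ _ t]) auto
  qed
  show ?thesis
  proof (rule left_submoduleI[OF M _ _ _ smult])
    show "torsion R M \<subseteq> carrier M" by (auto simp: torsion_def)
    show "\<zero>\<^bsub>M\<^esub> \<in> torsion R M" using one by (intro torsionI[of _ _ "\<one>\<^bsub>R\<^esub>"]) auto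
    fix x y assume x: "x \<in> torsion R M" and y: "y \<in> torsion R M"
    from x obtain s where s: "x \<in> carrier M" "s \<in> carrier R" "s \<noteq> \<zero>\<^bsub>R\<^esub>" "s \<odot>\<^bsub>M\<^esub> x = \<zero>\<^bsub>M\<^esub>"
      by (rule torsionE)
    from y have yM: "y \<in> carrier M" by (rule torsionE)
    \<comment> \<open>Instead of seeking a common annihilator, kill \<open>x\<close> by
      \<open>s\<close>: then \<open>s (x + y) = s y\<close> is torsion, and
      \<open>torsion_of_smult\<close> removes the factor \<open>s\<close>.\<close>
    have "s \<odot>\<^bsub>M\<^esub> (x \<oplus>\<^bsub>M\<^esub> y) = s \<odot>\<^bsub>M\<^esub> y" using s yM by (simp add: M.smult_r_distr)
    then have "s \<odot>\<^bsub>M\<^esub> (x \<oplus>\<^bsub>M\<^esub> y) \<in> torsion R M" using smult[OF s(2) y] by simp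
    then show "x \<oplus>\<^bsub>M\<^esub> y \<in> torsion R M" using torsion_of_smult[OF dom M] s yM by blast
  qed
qed

section \<open>Functionals on a span, one generator at a time\<close>

lemma mod_span_insert:
  assumes "left_module R M" "x \<in> carrier M" "S \<subseteq> carrier M"
  shows "mod_span R M (insert x S) = (\<lambda>r. r \<odot>\<^bsub>M\<^esub> x) ` carrier R <+>\<^bsub>M\<^esub> mod_span R M S"
    (is "?L = ?X <+>\<^bsub>M\<^esub> ?K")
proof -
  interpret M: left_module R M by fact
  note K = submodule_mod_span[OF assms(1,3)]
  have L: "submodule ?L R M" using assms by (intro submodule_mod_span) auto
  have X: "submodule ?X R M"
    using submodule_image[OF left_module_regular[OF M.R.ring_axioms] assms(1)
        mod_hom_smult_elt[OF assms(1,2)]] by simp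
  have "x \<in> ?X" using assms(2) by (intro image_eqI[of _ _ "\<one>\<^bsub>R\<^esub>"]) simp_all
  then have "x \<oplus>\<^bsub>M\<^esub> \<zero>\<^bsub>M\<^esub> \<in> ?X <+>\<^bsub>M\<^esub> ?K" using submoduleD(2)[OF K] by (rule set_addI)
  moreover have "y \<in> ?X <+>\<^bsub>M\<^esub> ?K" if "y \<in> S" for y
  proof -
    have "\<zero>\<^bsub>M\<^esub> \<oplus>\<^bsub>M\<^esub> y \<in> ?X <+>\<^bsub>M\<^esub> ?K"
      using submoduleD(2)[OF X] mod_span_superset[THEN subsetD, OF that] by (rule set_addI)
    then show ?thesis using that assms(3) by (simp add: subset_iff)
  qed
  ultimately have "insert x S \<subseteq> ?X <+>\<^bsub>M\<^esub> ?K" using assms(2) by auto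
  then have "?L \<subseteq> ?X <+>\<^bsub>M\<^esub> ?K" by (rule mod_span_least[OF submodule_sum[OF assms(1) X K]])
  moreover have "?X <+>\<^bsub>M\<^esub> ?K \<subseteq> ?L"
  proof -
    have S: "insert x S \<subseteq> ?L" by (rule mod_span_superset)
    then have "?K \<subseteq> ?L" by (intro mod_span_least[OF L]) auto
    then show ?thesis using S submoduleD(3,4)[OF L] by (fastforce simp: set_add_def')
  qed
  ultimately show ?thesis ..
qed

text \<open>The assumption \<open>eq\<close> does two jobs: at multiples \<open>s x = 0\<close> it
  makes \<open>r x \<mapsto> r a\<close> well defined on \<open>R x\<close>, and at the remaining
  \<open>s x\<close> in \<open>K\<close> it makes this map agree with \<open>g\<close>, so that the
  two can be glued.\<close>

lemma mod_hom_extend_one: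
  assumes M: "left_module R M" and N: "left_module R N" and K: "submodule K R M"
    and g: "g \<in> mod_hom R (M\<lparr>carrier := K\<rparr>) N" and x: "x \<in> carrier M" and a: "a \<in> carrier N"
    and eq: "\<And>s. \<lbrakk>s \<in> carrier R; s \<odot>\<^bsub>M\<^esub> x \<in> K\<rbrakk> \<Longrightarrow> s \<odot>\<^bsub>N\<^esub> a = g (s \<odot>\<^bsub>M\<^esub> x)"
  shows "\<exists>f\<in>mod_hom R (M\<lparr>carrier := (\<lambda>r. r \<odot>\<^bsub>M\<^esub> x) ` carrier R <+>\<^bsub>M\<^esub> K\<rparr>) N.
    f x = a \<and> (\<forall>y\<in>K. f y = g y)"
proof -
  interpret M: left_module R M by fact
  interpret N: left_module R N by fact
  note RM = left_module_regular[OF M.R.ring_axioms]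
  note K' = submoduleD[OF K]
  let ?X = "(\<lambda>r. r \<odot>\<^bsub>M\<^esub> x) ` carrier R"
  have g0: "g \<zero>\<^bsub>M\<^esub> = \<zero>\<^bsub>N\<^esub>" using mod_hom_zero[OF left_module_subset[OF M K] N g] by simp
  have X: "submodule ?X R M"
    using submodule_image[OF RM M mod_hom_smult_elt[OF M x]] by simp
  note MX = left_module_subset[OF M X]
  have q: "(\<lambda>r. r \<odot>\<^bsub>M\<^esub> x) \<in> mod_hom R (regular_module R) (M\<lparr>carrier := ?X\<rparr>)"
    by (rule mod_homI) (use mod_homD[OF mod_hom_smult_elt[OF M x]] in auto)
  \<comment> \<open>If \<open>r x = 0\<close>, then \<open>r x\<close> lies in \<open>K\<close>, and
    \<open>eq\<close> gives \<open>r a = g 0 = 0\<close>.\<close>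
  obtain k where k: "k \<in> mod_hom R (M\<lparr>carrier := ?X\<rparr>) N"
    "\<And>r. r \<in> carrier R \<Longrightarrow> k (r \<odot>\<^bsub>M\<^esub> x) = r \<odot>\<^bsub>N\<^esub> a"
    using mod_hom_factor[OF RM MX N q _ mod_hom_smult_elt[OF N a]] eq K'(2) g0 by auto
  have "k u = g u" if "u \<in> ?X" "u \<in> K" for u using that k(2) eq by auto
  from mod_hom_glue[OF M N X K k(1) g this]
  obtain f where f: "f \<in> mod_hom R (M\<lparr>carrier := ?X <+>\<^bsub>M\<^esub> K\<rparr>) N"
    "\<And>u y. \<lbrakk>u \<in> ?X; y \<in> K\<rbrakk> \<Longrightarrow> f (u \<oplus>\<^bsub>M\<^esub> y) = k u \<oplus>\<^bsub>N\<^esub> g y" by blast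
  have k0: "k \<zero>\<^bsub>M\<^esub> = \<zero>\<^bsub>N\<^esub>" using mod_hom_zero[OF MX N k(1)] by simp
  have "f x = a"
  proof -
    have "x \<in> ?X" using x by (intro image_eqI[of _ _ "\<one>\<^bsub>R\<^esub>"]) simp_all
    then show ?thesis using f(2)[of x "\<zero>\<^bsub>M\<^esub>"] k(2)[of "\<one>\<^bsub>R\<^esub>"] x a K'(2) g0 by simp
  qed
  moreover have "f y = g y" if "y \<in> K" for y
  proof -
    have "y \<in> carrier M" "g y \<in> carrier N" using that K'(1) mod_homD(1)[OF g, of y] by auto
    then show ?thesis using f(2)[OF submoduleD(2)[OF X] that] k0 by simp
  qed
  ultimately show ?thesis using f(1) by blast
qed

text \<open>Induction on the generators. If no nonzero multiple of the new generator
  \<open>x\<close> lies in the old span, a functional can send \<open>x\<close> to \<open>1\<close>.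
  Otherwise torsion passes from the old span to \<open>x\<close>, while a functional on the old span
  extends after right multiplication by a nonzero scalar.\<close>

lemma mod_span_torsion_or_functional:
  assumes dom: "nc_domain R" and l_ore: "left_ore R" and r_ore: "left_ore (opposite_ring R)"
    and M: "left_module R M" and S: "finite S" "S \<subseteq> carrier M"
  shows "mod_span R M S \<subseteq> torsion R M \<or>
    (\<exists>f\<in>mod_hom R (M\<lparr>carrier := mod_span R M S\<rparr>) (regular_module R). \<exists>x\<in>mod_span R M S. f x \<noteq> \<zero>\<^bsub>R\<^esub>)"
  using S
proof (induction S)
  case empty
  have "mod_span R M {} \<subseteq> torsion R M"
    by (rule mod_span_least[OF submodule_torsion[OF dom l_ore M]]) simp
  then show ?case ..
next
  case (insert x S)
  interpret M: left_module R M by fact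
  let ?K = "mod_span R M S" and ?L = "mod_span R M (insert x S)"
  note RM = left_module_regular[OF M.R.ring_axioms]
  note one = nc_domainD(2)[OF dom]
  from insert.prems have x: "x \<in> carrier M" and S: "S \<subseteq> carrier M" by auto
  note K = submodule_mod_span[OF M S]
  note ext = mod_hom_extend_one[OF M RM K _ x, folded mod_span_insert[OF M x S]]
  have xL: "x \<in> ?L" and KL: "?K \<subseteq> ?L"
    using mod_span_superset[of "insert x S" R M]
      mod_span_least[OF submodule_mod_span[OF M insert.prems], of S] by auto
  show ?case
  proof (cases "\<exists>r\<in>carrier R. r \<noteq> \<zero>\<^bsub>R\<^esub> \<and> r \<odot>\<^bsub>M\<^esub> x \<in> ?K")
    case False
    \<comment> \<open>The zero functional on the old span extends by \<open>x \<mapsto> 1\<close>,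
      because only \<open>s = 0\<close> puts \<open>s x\<close> into that span.\<close>
    have zero: "(\<lambda>_. \<zero>\<^bsub>R\<^esub>) \<in> mod_hom R (M\<lparr>carrier := ?K\<rparr>) (regular_module R)"
      by (rule mod_homI) simp_all
    obtain f where "f \<in> mod_hom R (M\<lparr>carrier := ?L\<rparr>) (regular_module R)" "f x = \<one>\<^bsub>R\<^esub>"
      using ext[OF zero, of "\<one>\<^bsub>R\<^esub>"] False by auto
    then show ?thesis using xL one by auto
  next
    case True
    then obtain r where r: "r \<in> carrier R" "r \<noteq> \<zero>\<^bsub>R\<^esub>" "r \<odot>\<^bsub>M\<^esub> x \<in> ?K" by blast
    from insert.IH[OF S] show ?thesis
    proof
      assume K_tors: "?K \<subseteq> torsion R M"
      then have "x \<in> torsion R M" using torsion_of_smult[OF dom M x r(1,2)] r(3) by blast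
      then have "insert x S \<subseteq> torsion R M" using K_tors mod_span_superset[of S R M] by auto
      then show ?thesis using mod_span_least[OF submodule_torsion[OF dom l_ore M]] by blast
    next
      assume "\<exists>f\<in>mod_hom R (M\<lparr>carrier := ?K\<rparr>) (regular_module R). \<exists>x\<in>?K. f x \<noteq> \<zero>\<^bsub>R\<^esub>"
      then obtain f y where f: "f \<in> mod_hom R (M\<lparr>carrier := ?K\<rparr>) (regular_module R)"
        and y: "y \<in> ?K" "f y \<noteq> \<zero>\<^bsub>R\<^esub>" by blast
      have fc: "f z \<in> carrier R" if "z \<in> ?K" for z using mod_homD(1)[OF f, of z] that by simp
      have fs: "f (s \<odot>\<^bsub>M\<^esub> z) = s \<otimes>\<^bsub>R\<^esub> f z" if "s \<in> carrier R" "z \<in> ?K" for s z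
        using mod_homD(3)[OF f, of s z] that by simp
      have fadd: "f (u \<oplus>\<^bsub>M\<^esub> z) = f u \<oplus>\<^bsub>R\<^esub> f z" if "u \<in> ?K" "z \<in> ?K" for u z
        using mod_homD(2)[OF f, of u z] that by simp
      \<comment> \<open>In fractions, an extension of \<open>f\<close> would have the value
        \<open>r^-1 f(r x)\<close> at \<open>x\<close>. The right Ore condition rewrites it as
        \<open>a d^-1\<close>, and multiplying \<open>f\<close> by \<open>d\<close> on the right,
        which preserves left linearity, clears the denominator.\<close>
      obtain d a where d: "d \<in> carrier R" "a \<in> carrier R" "d \<noteq> \<zero>\<^bsub>R\<^esub>"
        "f (r \<odot>\<^bsub>M\<^esub> x) \<otimes>\<^bsub>R\<^esub> d = r \<otimes>\<^bsub>R\<^esub> a"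
        using right_oreD[OF r_ore fc[OF r(3)] r(1,2)] by blast
      have g: "(\<lambda>z. f z \<otimes>\<^bsub>R\<^esub> d) \<in> mod_hom R (M\<lparr>carrier := ?K\<rparr>) (regular_module R)"
        by (rule mod_homI) (simp_all add: fc fs fadd d M.R.l_distr M.R.m_assoc)
      have "s \<otimes>\<^bsub>R\<^esub> a = f (s \<odot>\<^bsub>M\<^esub> x) \<otimes>\<^bsub>R\<^esub> d" if s: "s \<in> carrier R" "s \<odot>\<^bsub>M\<^esub> x \<in> ?K" for s
      proof -
        \<comment> \<open>Compatibility is known only for the multiplier \<open>r\<close>. The left
          Ore condition compares any other \<open>s\<close> with it:
          \<open>t s a = u r a = u f(r x) d = t f(s x) d\<close>, and \<open>t\<close>
          cancels.\<close>
        obtain t u where t: "t \<in> carrier R" "u \<in> carrier R" "t \<noteq> \<zero>\<^bsub>R\<^esub>" "t \<otimes>\<^bsub>R\<^esub> s = u \<otimes>\<^bsub>R\<^esub> r"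
          using left_oreD[OF l_ore s(1) r(1,2)] by blast
        have "t \<otimes>\<^bsub>R\<^esub> f (s \<odot>\<^bsub>M\<^esub> x) = f ((t \<otimes>\<^bsub>R\<^esub> s) \<odot>\<^bsub>M\<^esub> x)"
          using t(1) s x by (simp add: fs M.smult_assoc1)
        also have "\<dots> = u \<otimes>\<^bsub>R\<^esub> f (r \<odot>\<^bsub>M\<^esub> x)" unfolding t(4) using t r x by (simp add: fs M.smult_assoc1)
        finally have tu: "t \<otimes>\<^bsub>R\<^esub> f (s \<odot>\<^bsub>M\<^esub> x) = u \<otimes>\<^bsub>R\<^esub> f (r \<odot>\<^bsub>M\<^esub> x)" .
        have "t \<otimes>\<^bsub>R\<^esub> (s \<otimes>\<^bsub>R\<^esub> a) = u \<otimes>\<^bsub>R\<^esub> (r \<otimes>\<^bsub>R\<^esub> a)"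
          using t s r d by (simp add: M.R.m_assoc[symmetric])
        also have "\<dots> = t \<otimes>\<^bsub>R\<^esub> (f (s \<odot>\<^bsub>M\<^esub> x) \<otimes>\<^bsub>R\<^esub> d)"
          unfolding d(4)[symmetric] using t(1,2) s r d(1) tu by (simp add: M.R.m_assoc[symmetric] fc)
        finally have diff: "t \<otimes>\<^bsub>R\<^esub> (s \<otimes>\<^bsub>R\<^esub> a \<ominus>\<^bsub>R\<^esub> f (s \<odot>\<^bsub>M\<^esub> x) \<otimes>\<^bsub>R\<^esub> d) = \<zero>\<^bsub>R\<^esub>"
          using t s d fc[OF s(2)]
          by (simp add: a_minus_def M.R.r_distr M.R.r_minus M.R.r_neg)
        have "s \<otimes>\<^bsub>R\<^esub> a \<ominus>\<^bsub>R\<^esub> f (s \<odot>\<^bsub>M\<^esub> x) \<otimes>\<^bsub>R\<^esub> d = \<zero>\<^bsub>R\<^esub>"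
          using nc_domainD(3)[OF dom t(1) _ diff] t(3) s d(1,2) fc[OF s(2)] by simp
        then show ?thesis using s d fc[OF s(2)] by (simp add: M.R.minus_eq_zero_iff)
      qed
      then obtain h where h: "h \<in> mod_hom R (M\<lparr>carrier := ?L\<rparr>) (regular_module R)"
        "\<And>z. z \<in> ?K \<Longrightarrow> h z = f z \<otimes>\<^bsub>R\<^esub> d" using ext[OF g, of a] d(2) by auto
      have "h y \<noteq> \<zero>\<^bsub>R\<^esub>" using h(2)[OF y(1)] nc_domainD(3)[OF dom fc[OF y(1)] d(1)] y(2) d(3) by auto
      then show ?thesis using h(1) y(1) KL by blast
    qed
  qed
qed

text \<open>With a finite generating set the span is all of \<open>M\<close>, and without nonzero
  functionals only the torsion alternative remains.\<close>

lemma fin_gen_torsion: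
  assumes "nc_domain R" "left_ore R" "left_ore (opposite_ring R)" "left_module R M" "fin_gen R M"
    and "\<And>f x. \<lbrakk>f \<in> mod_hom R M (regular_module R); x \<in> carrier M\<rbrakk> \<Longrightarrow> f x = \<zero>\<^bsub>R\<^esub>"
  shows "torsion R M = carrier M"
proof -
  obtain S where S: "finite S" "S \<subseteq> carrier M" "mod_span R M S = carrier M"
    using assms(5) by (auto simp: fin_gen_def)
  have hom: "f \<in> mod_hom R M (regular_module R)"
    if "f \<in> mod_hom R (M\<lparr>carrier := carrier M\<rparr>) (regular_module R)" for f
    by (rule mod_homI) (use mod_homD[OF that] in auto)
  have "carrier M \<subseteq> torsion R M"
    using mod_span_torsion_or_functional[OF assms(1-4) S(1,2)] assms(6) hom unfolding S(3) by blast
  then show ?thesis by (auto simp: torsion_def)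
qed

section \<open>Vanishing of Ext\<close>

text \<open>In a trivial factor group the coset of \<open>z\<close> is the set of coboundaries
  itself. As the neutral element is a coboundary, \<open>z\<close> lies in its own coset.\<close>

lemma trivial_Hom_cohomologyD:
  assumes "left_module R (P i)" "left_module R N" "trivial_group (Hom_cohomology R P d N i)"
    and one: "\<one>\<^bsub>Hom_group R (P i) N\<^esub> \<in> coboundaries R P d N i" and z: "z \<in> cocycles R P d N i"
  shows "z \<in> coboundaries R P d N i"
proof -
  interpret G: comm_group "Hom_group R (P i) N" by (rule Hom_comm_group[OF assms(1,2)])
  let ?G = "Hom_group R (P i) N" and ?Z = "cocycles R P d N i" and ?B = "coboundaries R P d N i"
  have zG: "z \<in> carrier ?G" using z by (simp add: cocycles_def)
  have "?B #>\<^bsub>?G\<^esub> z = ?B #>\<^bsub>?G\<lparr>carrier := ?Z\<rparr>\<^esub> z" by (simp add: r_coset_def)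
  also have "\<dots> \<in> carrier (Hom_cohomology R P d N i)"
    using z by (auto simp: Hom_cohomology_def FactGroup_def RCOSETS_def)
  also have "\<dots> = {?B}" using assms(3) by (simp add: trivial_group_def Hom_cohomology_def FactGroup_def)
  finally have "?B #>\<^bsub>?G\<^esub> z = ?B" by simp
  moreover have "\<one>\<^bsub>?G\<^esub> \<otimes>\<^bsub>?G\<^esub> z \<in> ?B #>\<^bsub>?G\<^esub> z" using one by (auto simp: r_coset_def)
  ultimately show ?thesis using zG by simp
qed

lemma restrict_mod_hom:
  assumes "left_module R M" "f \<in> mod_hom R M N"
  shows "restrict f (carrier M) \<in> carrier (Hom_group R M N)"
proof -
  interpret M: left_module R M by fact
  have "restrict f (carrier M) \<in> mod_hom R M N" by (rule mod_homI) (simp_all add: mod_homD[OF assms(2)])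
  then show ?thesis by (simp add: Hom_group_def)
qed

text \<open>The composite of \<open>f\<close> with the augmentation \<open>\<epsilon>\<close> is a
  cocycle in degree 0, where the only coboundary is zero. So the composite vanishes, and
  \<open>\<epsilon>\<close> is onto.\<close>

lemma Ext_0_trivialD:
  fixes R :: "('r, 'x) ring_scheme" and T :: "('r, 't, 'y) module_scheme"
  assumes T: "left_module R T" and N: "left_module R N" and triv: "trivial_group (Ext R 0 T N)"
    and f: "f \<in> mod_hom R T N" and x: "x \<in> carrier T"
  shows "f x = \<zero>\<^bsub>N\<^esub>"
proof -
  obtain P d where Pd: "chosen_resolution R T = (P, d)" by fastforce
  obtain \<epsilon> where res: "proj_resolution R T P d \<epsilon>" using chosen_resolution[OF T Pd] by blast
  then have P: "left_module R (P n)" for n by (simp add: proj_resolution_def projective_def)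
  have \<epsilon>: "\<epsilon> \<in> mod_hom R (P 0) T" "\<epsilon> ` carrier (P 0) = carrier T"
    and d: "d 0 \<in> mod_hom R (P 1) (P 0)" "d 0 ` carrier (P 1) = a_kernel (P 0) T \<epsilon>"
    using res by (auto simp: proj_resolution_def)
  let ?z = "restrict (\<lambda>x. f (\<epsilon> x)) (carrier (P 0))"
  have "?z \<in> cocycles R P d N 0"
  proof -
    have "\<epsilon> (d 0 y) = \<zero>\<^bsub>T\<^esub>" if "y \<in> carrier (P 1)" for y
      using imageI[OF that, of "d 0"] unfolding d(2) by (simp add: a_kernel_def')
    then show ?thesis
      using restrict_mod_hom[OF P mod_hom_comp[OF \<epsilon>(1) f]] mod_homD(1)[OF d(1)] mod_hom_zero[OF T N f]
      by (simp add: cocycles_def)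
  qed
  then have "?z \<in> coboundaries R P d N 0"
    by (rule trivial_Hom_cohomologyD[OF P N, rotated 2])
      (use triv in \<open>simp_all add: Ext_def Pd\<close>)
  then have z: "?z = (\<lambda>y\<in>carrier (P 0). \<zero>\<^bsub>N\<^esub>)" by (simp add: Hom_group_def)
  obtain y where y: "y \<in> carrier (P 0)" "x = \<epsilon> y" using x \<epsilon>(2) by auto
  then show ?thesis using fun_cong[OF z, of y] by simp
qed

text \<open>The sequence \<open>Hom(P, N) \<rightarrow> Hom(C, N) \<rightarrow> Ext\<^sup>1(P/C, N)\<close>, with \<open>Ext\<close> computed from a resolution
  \<open>Q\<close> of \<open>P/C\<close>. Comparison maps \<open>u: Q\<^sub>0 \<rightarrow> P\<close> and \<open>v: P \<rightarrow> Q\<^sub>0\<close> over \<open>P/C\<close> make \<open>f \<circ> u \<circ> d\<close> a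
  cocycle, hence equal to \<open>g \<circ> d\<close> for some \<open>g\<close>, and the extension is
  \<open>g \<circ> v + f \<circ> (1 - u \<circ> v)\<close>.\<close>

lemma Ext_1_trivial_extend:
  fixes R :: "('r, 'x) ring_scheme" and P :: "('r, 'a, 'y) module_scheme"
  assumes P: "projective R P" and C: "submodule C R P" and N: "left_module R N"
    and triv: "trivial_group (Ext R 1 (quot_module R P C) N)"
    and f: "f \<in> mod_hom R (P\<lparr>carrier := C\<rparr>) N"
  shows "\<exists>F\<in>mod_hom R P N. \<forall>x\<in>C. F x = f x"
proof -
  have PM: "left_module R P" using P by (simp add: projective_def)
  interpret P: left_module R P by fact
  interpret N: left_module R N by fact
  let ?T = "quot_module R P C" and ?q = "\<lambda>x. C +>\<^bsub>P\<^esub> x"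
  note T = left_module_quot[OF PM C] and q = quot_hom[OF PM C] quot_surj[OF PM C]
    and q0 = quot_eq_zero_iff[OF PM C]
  note MC = left_module_subset[OF PM C]
  obtain Q d where Qd: "chosen_resolution R ?T = (Q, d)" by fastforce
  obtain \<epsilon> where res: "proj_resolution R ?T Q d \<epsilon>" using chosen_resolution[OF T Qd] by blast
  then have Q: "projective R (Q n)" for n by (simp add: proj_resolution_def)
  then have QM: "left_module R (Q n)" for n by (simp add: projective_def)
  have \<epsilon>: "\<epsilon> \<in> mod_hom R (Q 0) ?T" "\<epsilon> ` carrier (Q 0) = carrier ?T"
    and d: "d 0 \<in> mod_hom R (Q (Suc 0)) (Q 0)" "d 0 ` carrier (Q (Suc 0)) = a_kernel (Q 0) ?T \<epsilon>"
    and d': "d (Suc 0) \<in> mod_hom R (Q (Suc (Suc 0))) (Q (Suc 0))" "d (Suc 0) ` carrier (Q (Suc (Suc 0))) = a_kernel (Q (Suc 0)) (Q 0) (d 0)"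
    using res unfolding proj_resolution_def by simp_all
  interpret Q0: left_module R "Q 0" by (rule QM)
  interpret T: left_module R ?T by (rule T)
  obtain u where u: "u \<in> mod_hom R (Q 0) P" "\<And>x. x \<in> carrier (Q 0) \<Longrightarrow> ?q (u x) = \<epsilon> x"
    using projective_lift[OF Q PM T q \<epsilon>(1)] by blast
  obtain v where v: "v \<in> mod_hom R P (Q 0)" "\<And>x. x \<in> carrier P \<Longrightarrow> \<epsilon> (v x) = ?q x"
    using projective_lift[OF P QM T \<epsilon> q(1)] by blast
  \<comment> \<open>The map \<open>u\<close> lies over \<open>P/C\<close> and
    \<open>\<epsilon> d = 0\<close>, so \<open>u d\<close> lands in \<open>C\<close>, where
    \<open>f\<close> is defined.\<close>
  have ud: "u (d 0 y) \<in> C" if y: "y \<in> carrier (Q (Suc 0))" for y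
  proof -
    have "d 0 y \<in> a_kernel (Q 0) ?T \<epsilon>" using imageI[OF y, of "d 0"] unfolding d(2) .
    then have "d 0 y \<in> carrier (Q 0)" "\<epsilon> (d 0 y) = \<zero>\<^bsub>?T\<^esub>" by (simp_all add: a_kernel_def')
    then show ?thesis using u(2)[of "d 0 y"] q0[of "u (d 0 y)"] mod_homD(1)[OF u(1)] by simp
  qed
  have ud_hom: "(\<lambda>y. u (d 0 y)) \<in> mod_hom R (Q (Suc 0)) (P\<lparr>carrier := C\<rparr>)"
    by (rule mod_homI) (simp_all add: ud mod_homD[OF d(1)] mod_homD[OF u(1)])
  let ?z = "restrict (\<lambda>y. f (u (d 0 y))) (carrier (Q (Suc 0)))"
  have "?z \<in> cocycles R Q d N (Suc 0)"
  proof -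
    have "d (Suc 0) y \<in> carrier (Q (Suc 0))" "f (u (d 0 (d (Suc 0) y))) = \<zero>\<^bsub>N\<^esub>" if "y \<in> carrier (Q (Suc (Suc 0)))" for y
    proof -
      have "d (Suc 0) y \<in> a_kernel (Q (Suc 0)) (Q 0) (d 0)" using imageI[OF that, of "d (Suc 0)"] unfolding d'(2) .
      then show "d (Suc 0) y \<in> carrier (Q (Suc 0))" "f (u (d 0 (d (Suc 0) y))) = \<zero>\<^bsub>N\<^esub>"
        using mod_hom_zero[OF QM PM u(1)] mod_hom_zero[OF MC N f] by (simp_all add: a_kernel_def')
    qed
    then show ?thesis
      using restrict_mod_hom[OF QM mod_hom_comp[OF ud_hom f]] by (simp add: cocycles_def)
  qed
  moreover have "\<one>\<^bsub>Hom_group R (Q (Suc 0)) N\<^esub> \<in> coboundaries R Q d N (Suc 0)"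
  proof -
    interpret G: comm_group "Hom_group R (Q 0) N" by (rule Hom_comm_group[OF QM N])
    have "\<one>\<^bsub>Hom_group R (Q (Suc 0)) N\<^esub> = compose (carrier (Q (Suc 0))) \<one>\<^bsub>Hom_group R (Q 0) N\<^esub> (d 0)"
      by (auto simp: Hom_group_def compose_def mod_homD(1)[OF d(1)] intro!: restrict_ext)
    then show ?thesis by (simp only: coboundaries.simps) (rule imageI[OF G.one_closed])
  qed
  moreover have "trivial_group (Hom_cohomology R Q d N (Suc 0))" using triv by (simp add: Ext_def Qd)
  ultimately have "?z \<in> coboundaries R Q d N (Suc 0)"
    using trivial_Hom_cohomologyD[of R Q "Suc 0" N d ?z, OF QM N] by blast
  then obtain g where g: "g \<in> mod_hom R (Q 0) N" and z: "?z = compose (carrier (Q (Suc 0))) g (d 0)"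
    by (auto simp: Hom_group_def)
  have gd: "g (d 0 y) = f (u (d 0 y))" if "y \<in> carrier (Q (Suc 0))" for y
    using fun_cong[OF z, of y] that by (simp add: compose_def)
  have w: "(\<lambda>x. x \<ominus>\<^bsub>P\<^esub> u (v x)) \<in> mod_hom R P P"
    by (rule mod_hom_diff[OF PM PM mod_hom_id mod_hom_comp[OF v(1) u(1)]])
  \<comment> \<open>Both \<open>u\<close> and \<open>v\<close> respect the maps to
    \<open>P/C\<close>, so \<open>u v\<close> induces the identity there and \<open>1 - u v\<close>
    maps into \<open>C\<close>.\<close>
  have "x \<ominus>\<^bsub>P\<^esub> u (v x) \<in> C" if x: "x \<in> carrier P" for x
    using x q0[of "x \<ominus>\<^bsub>P\<^esub> u (v x)"] mod_homD(1)[OF w x] u(2)[of "v x"] v(2)[OF x]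
    by (simp add: mod_hom_minus[OF PM T q(1)] mod_homD(1)[OF v(1)] mod_homD(1)[OF u(1)]
        T.M.minus_eq_zero_iff mod_homD(1)[OF q(1)])
  then have w': "(\<lambda>x. x \<ominus>\<^bsub>P\<^esub> u (v x)) \<in> mod_hom R P (P\<lparr>carrier := C\<rparr>)"
    using mod_homD[OF w] by (intro mod_homI) simp_all
  define F where "F x = g (v x) \<oplus>\<^bsub>N\<^esub> f (x \<ominus>\<^bsub>P\<^esub> u (v x))" for x
  have F: "F \<in> mod_hom R P N"
    unfolding F_def by (rule mod_hom_add[OF PM N mod_hom_comp[OF v(1) g] mod_hom_comp[OF w' f]])
  have "F x = f x" if x: "x \<in> C" for x
  proof -
    have xP: "x \<in> carrier P" using x submoduleD(1)[OF C] by auto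
    \<comment> \<open>For \<open>x\<close> in \<open>C\<close> the element \<open>v x\<close> lies
      in the kernel of \<open>\<epsilon>\<close>, that is, in the image of \<open>d 0\<close>, where
      \<open>g\<close> agrees with \<open>f u\<close>.\<close>
    have "\<epsilon> (v x) = \<zero>\<^bsub>?T\<^esub>" using q0[OF xP] x v(2)[OF xP] by simp
    then have "v x \<in> d 0 ` carrier (Q (Suc 0))"
      unfolding d(2) using mod_homD(1)[OF v(1) xP] by (simp add: a_kernel_def')
    then obtain y where y: "y \<in> carrier (Q (Suc 0))" "v x = d 0 y" by auto
    have uvx: "u (v x) \<in> C" using y ud by simp
    have wC: "x \<ominus>\<^bsub>P\<^esub> u (v x) \<in> C" using mod_homD(1)[OF w' xP] by simp
    have "F x = f (u (v x)) \<oplus>\<^bsub>N\<^esub> f (x \<ominus>\<^bsub>P\<^esub> u (v x))" using gd[OF y(1)] by (simp add: F_def y(2))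
    also have "\<dots> = f (u (v x) \<oplus>\<^bsub>P\<^esub> (x \<ominus>\<^bsub>P\<^esub> u (v x)))"
      using mod_homD(2)[OF f, of "u (v x)" "x \<ominus>\<^bsub>P\<^esub> u (v x)"] uvx wC by simp
    also have "u (v x) \<oplus>\<^bsub>P\<^esub> (x \<ominus>\<^bsub>P\<^esub> u (v x)) = x"
    proof -
      have "u (v x) \<in> carrier P" using uvx submoduleD(1)[OF C] by auto
      then show ?thesis using xP
        by (simp add: a_minus_def P.M.a_lcomm[of "u (v x)" x] P.M.r_neg)
    qed
    finally show ?thesis .
  qed
  then show ?thesis by (intro bexI[OF _ F] ballI)
qed

section \<open>Finitely generated projective modules\<close>

text \<open>The dual basis property: the identity of \<open>P\<close> lifts along the epimorphism
  from the free module on the generators, and the components of the lift are coordinate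
  functionals.\<close>

lemma fin_gen_projective_coordinates:
  assumes P: "projective R P" and S: "finite S" "S \<subseteq> carrier P" "mod_span R P S = carrier P"
  shows "\<exists>h\<in>mod_hom R P (free_module R S). \<forall>x\<in>carrier P. lin_ext R P (\<lambda>s. s) (h x) = x"
proof -
  have PM: "left_module R P" using P by (simp add: projective_def)
  interpret P: left_module R P by fact
  note F = left_module_free[OF P.R.ring_axioms, of S]
  have l: "lin_ext R P (\<lambda>s. s) \<in> mod_hom R (free_module R S) P"
    using S(2) by (intro lin_ext_hom[OF PM]) auto
  have "S \<subseteq> lin_ext R P (\<lambda>s. s) ` carrier (free_module R S)"
  proof
    fix s assume s: "s \<in> S"
    then have "lin_ext R P (\<lambda>s. s) (unit_vec R s) = s"
      using S(2) by (intro lin_ext_unit_vec[OF PM]) auto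
    then show "s \<in> lin_ext R P (\<lambda>s. s) ` carrier (free_module R S)"
      using unit_vec_closed[OF P.R.ring_axioms s] by (metis imageI)
  qed
  then have "carrier P \<subseteq> lin_ext R P (\<lambda>s. s) ` carrier (free_module R S)"
    unfolding S(3)[symmetric] by (rule mod_span_least[OF submodule_image[OF F PM l]])
  then have "lin_ext R P (\<lambda>s. s) ` carrier (free_module R S) = carrier P"
    using mod_homD(1)[OF l] by auto
  from projective_lift[OF P F PM l this mod_hom_id] show ?thesis .
qed

lemma free_module_coordinate: "(\<lambda>f. f s) \<in> mod_hom R (free_module R S) (regular_module R)" if "ring R"
proof (rule mod_homI)
  show "f s \<in> carrier (regular_module R)" if "f \<in> carrier (free_module R S)" for f
    using free_carrierD(1)[OF \<open>ring R\<close> that] by simp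
qed (simp_all add: free_module_def)

text \<open>Finiteness of \<open>S\<close> provides the finite support that
  \<open>free_module\<close> demands.\<close>

lemma free_module_mod_homI:
  assumes "ring R" "left_module R M" "finite S"
    and \<psi>: "\<And>s. s \<in> S \<Longrightarrow> \<psi> s \<in> mod_hom R M (regular_module R)"
  shows "(\<lambda>x s. if s \<in> S then \<psi> s x else \<zero>\<^bsub>R\<^esub>) \<in> mod_hom R M (free_module R S)"
proof -
  interpret ring R by fact
  show ?thesis
  proof (rule mod_homI)
    fix x assume x: "x \<in> carrier M"
    show "(\<lambda>s. if s \<in> S then \<psi> s x else \<zero>\<^bsub>R\<^esub>) \<in> carrier (free_module R S)"
      by (rule free_carrierI[of _ _ S]) (use assms(3) mod_homD(1)[OF \<psi> x] in auto)
  qed (auto simp: free_module_def fun_eq_iff mod_homD[OF \<psi>])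
qed

text \<open>In coordinates on \<open>P\<close>, the map \<open>p\<close> is a finite family of
  functionals on \<open>C\<close>. Each one extends to \<open>M\<close>, and \<open>lin_ext\<close>
  reassembles them into a map to \<open>P\<close>.\<close>

lemma extend_to_fin_gen_projective:
  assumes P: "projective R P" "fin_gen R P" and M: "left_module R M" and C: "submodule C R M"
    and ext: "\<And>f. f \<in> mod_hom R (M\<lparr>carrier := C\<rparr>) (regular_module R) \<Longrightarrow>
      \<exists>F\<in>mod_hom R M (regular_module R). \<forall>x\<in>C. F x = f x"
    and p: "p \<in> mod_hom R (M\<lparr>carrier := C\<rparr>) P"
  shows "\<exists>e\<in>mod_hom R M P. \<forall>x\<in>C. e x = p x"
proof -
  have PM: "left_module R P" using P by (simp add: projective_def)
  interpret P: left_module R P by fact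
  note R = P.R.ring_axioms
  obtain S where S: "finite S" "S \<subseteq> carrier P" "mod_span R P S = carrier P"
    using P(2) by (auto simp: fin_gen_def)
  obtain h where h: "h \<in> mod_hom R P (free_module R S)"
    "\<And>x. x \<in> carrier P \<Longrightarrow> lin_ext R P (\<lambda>s. s) (h x) = x"
    using fin_gen_projective_coordinates[OF P(1) S] by blast
  have "\<exists>F\<in>mod_hom R M (regular_module R). \<forall>x\<in>C. F x = h (p x) s" for s
    using ext[OF mod_hom_comp[OF p mod_hom_comp[OF h(1) free_module_coordinate[OF R, of s]]]] .
  then obtain \<psi> where \<psi>: "\<And>s. \<psi> s \<in> mod_hom R M (regular_module R)"
    "\<And>s x. x \<in> C \<Longrightarrow> \<psi> s x = h (p x) s" by metis
  let ?H = "\<lambda>x s. if s \<in> S then \<psi> s x else \<zero>\<^bsub>R\<^esub>"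
  have H: "?H \<in> mod_hom R M (free_module R S)"
    by (rule free_module_mod_homI[OF R M S(1) \<psi>(1)])
  have l: "lin_ext R P (\<lambda>s. s) \<in> mod_hom R (free_module R S) P"
    using S(2) by (intro lin_ext_hom[OF PM]) auto
  have "lin_ext R P (\<lambda>s. s) (?H x) = p x" if x: "x \<in> C" for x
  proof -
    have px: "p x \<in> carrier P" using mod_homD(1)[OF p] x by simp
    \<comment> \<open>The extensions are cut off outside \<open>S\<close>; on \<open>C\<close> this
      changes nothing, because \<open>h (p x)\<close> is supported in \<open>S\<close>.\<close>
    have "h (p x) s = \<zero>\<^bsub>R\<^esub>" if "s \<notin> S" for s
      using free_carrierD(3)[OF R mod_homD(1)[OF h(1) px]] that by auto
    then have "?H x = h (p x)" using \<psi>(2)[OF x] by auto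
    then show ?thesis using h(2)[OF px] by simp
  qed
  then show ?thesis by (intro bexI[OF _ mod_hom_comp[OF H l]] ballI)
qed

text \<open>The coordinates of a torsion element are killed by a nonzero scalar, so they vanish in a
  domain, and the coordinates determine the element.\<close>

lemma fin_gen_projective_torsion_free:
  assumes dom: "nc_domain R" and P: "projective R P" "fin_gen R P" and x: "x \<in> torsion R P"
  shows "x = \<zero>\<^bsub>P\<^esub>"
proof -
  have PM: "left_module R P" using P by (simp add: projective_def)
  interpret P: left_module R P by fact
  note R = P.R.ring_axioms
  obtain S where S: "finite S" "S \<subseteq> carrier P" "mod_span R P S = carrier P"
    using P(2) by (auto simp: fin_gen_def)
  obtain h where h: "h \<in> mod_hom R P (free_module R S)"
    "\<And>x. x \<in> carrier P \<Longrightarrow> lin_ext R P (\<lambda>s. s) (h x) = x"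
    using fin_gen_projective_coordinates[OF P(1) S] by blast
  from x obtain r where r: "x \<in> carrier P" "r \<in> carrier R" "r \<noteq> \<zero>\<^bsub>R\<^esub>" "r \<odot>\<^bsub>P\<^esub> x = \<zero>\<^bsub>P\<^esub>"
    by (rule torsionE)
  have "h x s = \<zero>\<^bsub>R\<^esub>" for s
  proof -
    note c = mod_hom_comp[OF h(1) free_module_coordinate[OF R, of s]]
    have "r \<otimes>\<^bsub>R\<^esub> h x s = \<zero>\<^bsub>R\<^esub>"
      using mod_homD(3)[OF c r(2,1)] r(4) mod_hom_zero[OF PM left_module_regular[OF R] c] by simp
    then show ?thesis using nc_domainD(3)[OF dom r(2)] r(3) mod_homD(1)[OF c r(1)] by auto
  qed
  then have "lin_ext R P (\<lambda>s. s) (h x) = \<zero>\<^bsub>P\<^esub>" by (simp add: lin_ext_def)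
  then show ?thesis using h(2)[OF r(1)] by simp
qed

section \<open>Projectivity of the torsion-free factor\<close>

theorem theorem7p1:
  fixes R :: "('r, 'x) ring_scheme" and M :: "('r, 'm, 'y) module_scheme"
  assumes "nc_domain R" and "two_sided_noetherian R"
    and "left_module R M" and "fin_gen R M"
    and "projective_up_to_grade TYPE('p) R M 2"
  shows "projective R (quot_module R M (torsion R M))"
proof -
  note dom = assms(1) and M = assms(3)
  interpret M: left_module R M by (rule M)
  note R = M.R.ring_axioms
  note RM = left_module_regular[OF R]
  note ore = two_sided_noetherian_ore[OF assms(1,2)]
  obtain P :: "('r, 'p) module" and \<pi> A B
    where P: "projective R P" "fin_gen R P" and \<pi>: "\<pi> \<in> mod_hom R P M" "\<pi> ` carrier P = carrier M"
      and A_def: "A = a_kernel P M \<pi>" and B: "submodule B R P" and AB: "A \<inter> B = {\<zero>\<^bsub>P\<^esub>}"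
      and grade: "grade_at_least R (quot_module R P (A <+>\<^bsub>P\<^esub> B)) 2"
    using assms(4,5) unfolding projective_up_to_grade_def by blast
  have PM: "left_module R P" using P by (simp add: projective_def)
  interpret P: left_module R P by (rule PM)
  have A: "submodule A R P" unfolding A_def by (rule mod_hom_kernel_submodule[OF PM M \<pi>(1)])
  note C = submodule_sum[OF PM A B]
  let ?C = "A <+>\<^bsub>P\<^esub> B"
  note T = left_module_quot[OF PM C] and q = quot_hom[OF PM C] quot_surj[OF PM C]
  \<comment> \<open>Grade at least 2 is the vanishing in the two degrees \<open>i = 0\<close> and
    \<open>i = 1\<close>.\<close>
  have Ext: "trivial_group (Ext R 0 (quot_module R P ?C) (regular_module R))"
    "trivial_group (Ext R 1 (quot_module R P ?C) (regular_module R))"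
    using grade unfolding grade_at_least_def by auto

  have tors: "\<exists>r\<in>carrier R. r \<noteq> \<zero>\<^bsub>R\<^esub> \<and> r \<odot>\<^bsub>P\<^esub> x \<in> ?C" if x: "x \<in> carrier P" for x
  proof -
    have "torsion R (quot_module R P ?C) = carrier (quot_module R P ?C)"
      by (rule fin_gen_torsion[OF dom ore T fin_gen_image[OF PM T q P(2)]])
        (simp add: Ext_0_trivialD[OF T RM Ext(1)])
    then have "?C +>\<^bsub>P\<^esub> x \<in> torsion R (quot_module R P ?C)" using mod_homD(1)[OF q(1) x] by simp
    then obtain r where r: "r \<in> carrier R" "r \<noteq> \<zero>\<^bsub>R\<^esub>"
      "r \<odot>\<^bsub>quot_module R P ?C\<^esub> (?C +>\<^bsub>P\<^esub> x) = \<zero>\<^bsub>quot_module R P ?C\<^esub>" by (rule torsionE)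
    then have "r \<odot>\<^bsub>P\<^esub> x \<in> ?C"
      using quot_eq_zero_iff[OF PM C, of "r \<odot>\<^bsub>P\<^esub> x"] mod_homD(3)[OF q(1) r(1) x] x by simp
    then show ?thesis using r by blast
  qed

  obtain e where e: "e \<in> mod_hom R P P" "\<And>a b. \<lbrakk>a \<in> A; b \<in> B\<rbrakk> \<Longrightarrow> e (a \<oplus>\<^bsub>P\<^esub> b) = a"
  proof -
    \<comment> \<open>The projection onto \<open>A\<close> along \<open>B\<close> is the identity of
      \<open>A\<close> glued with zero on \<open>B\<close>; they agree because \<open>A\<close> and
      \<open>B\<close> meet only in zero.\<close>
    have zero: "(\<lambda>_. \<zero>\<^bsub>P\<^esub>) \<in> mod_hom R (P\<lparr>carrier := B\<rparr>) P"
      by (rule mod_homI) (simp_all add: left_module_smult_zero_right[OF PM])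
    have eq: "x = \<zero>\<^bsub>P\<^esub>" if "x \<in> A" "x \<in> B" for x using AB that by blast
    obtain p where p: "p \<in> mod_hom R (P\<lparr>carrier := ?C\<rparr>) P"
      "\<And>a b. \<lbrakk>a \<in> A; b \<in> B\<rbrakk> \<Longrightarrow> p (a \<oplus>\<^bsub>P\<^esub> b) = a \<oplus>\<^bsub>P\<^esub> \<zero>\<^bsub>P\<^esub>"
      using mod_hom_glue[OF PM PM A B mod_hom_subset[OF mod_hom_id submoduleD(1)[OF A]] zero eq]
      by blast
    obtain e where e: "e \<in> mod_hom R P P" "\<And>x. x \<in> ?C \<Longrightarrow> e x = p x"
      using extend_to_fin_gen_projective[OF P PM C
          Ext_1_trivial_extend[OF P(1) C RM Ext(2)] p(1)] by blast
    have "e (a \<oplus>\<^bsub>P\<^esub> b) = a" if "a \<in> A" "b \<in> B" for a b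
    proof -
      have "a \<in> carrier P" using that submoduleD(1)[OF A] by auto
      then show ?thesis using e(2)[OF set_addI[OF that]] p(2)[OF that] by simp
    qed
    then show thesis by (rule that[OF e(1)])
  qed
  have eA: "e a = a" if a: "a \<in> A" for a
  proof -
    have "a \<in> carrier P" using a submoduleD(1)[OF A] by auto
    then show ?thesis using e(2)[OF a submoduleD(2)[OF B]] by simp
  qed

  note t = submodule_torsion[OF dom ore(1) M]
  let ?Q = "quot_module R M (torsion R M)" and ?k = "\<lambda>x. torsion R M +>\<^bsub>M\<^esub> x"
  note Q = left_module_quot[OF M t] and k = quot_hom[OF M t] quot_surj[OF M t]
    and k0 = quot_eq_zero_iff[OF M t]
  have k\<pi>: "(\<lambda>x. ?k (\<pi> x)) \<in> mod_hom R P ?Q" by (rule mod_hom_comp[OF \<pi>(1) k(1)])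
  have k\<pi>_surj: "(\<lambda>x. ?k (\<pi> x)) ` carrier P = carrier ?Q"
    using k(2) \<pi>(2) by (metis image_image)
  \<comment> \<open>The kernel of \<open>P \<rightarrow> M/t(M)\<close> consists of the elements
    with a nonzero multiple in \<open>A\<close>, since \<open>A\<close> is the kernel of
    \<open>\<pi>\<close>.\<close>
  have k\<pi>0: "?k (\<pi> x) = \<zero>\<^bsub>?Q\<^esub> \<longleftrightarrow> (\<exists>r\<in>carrier R. r \<noteq> \<zero>\<^bsub>R\<^esub> \<and> r \<odot>\<^bsub>P\<^esub> x \<in> A)"
    if x: "x \<in> carrier P" for x
    using x k0[OF mod_homD(1)[OF \<pi>(1) x]] mod_homD(1)[OF \<pi>(1) x]
    by (auto simp: A_def a_kernel_def' torsion_def mod_homD(3)[OF \<pi>(1)])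
  have fix_ker: "e x = x" if x: "x \<in> carrier P" "?k (\<pi> x) = \<zero>\<^bsub>?Q\<^esub>" for x
  proof -
    obtain r where r: "r \<in> carrier R" "r \<noteq> \<zero>\<^bsub>R\<^esub>" "r \<odot>\<^bsub>P\<^esub> x \<in> A" using x k\<pi>0 by blast
    note ex = mod_homD(1)[OF e(1) x(1)]
    \<comment> \<open>The endomorphism \<open>e\<close> fixes \<open>r x\<close> because this
      multiple lies in \<open>A\<close>; hence \<open>r\<close> kills
      \<open>e x - x\<close>.\<close>
    have "r \<odot>\<^bsub>P\<^esub> (e x \<ominus>\<^bsub>P\<^esub> x) = \<zero>\<^bsub>P\<^esub>"
      using eA[OF r(3)] r x ex mod_homD(3)[OF e(1) r(1) x(1)]
      by (simp add: a_minus_def P.smult_r_distr left_module_smult_neg[OF PM] P.M.r_neg)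
    then have "e x \<ominus>\<^bsub>P\<^esub> x \<in> torsion R P" using r x ex by (intro torsionI[of _ _ r]) auto
    then have "e x \<ominus>\<^bsub>P\<^esub> x = \<zero>\<^bsub>P\<^esub>" by (rule fin_gen_projective_torsion_free[OF dom P])
    then show ?thesis using x ex by (simp add: P.M.minus_eq_zero_iff)
  qed
  have e_ker: "?k (\<pi> (e x)) = \<zero>\<^bsub>?Q\<^esub>" if x: "x \<in> carrier P" for x
  proof -
    obtain r where r: "r \<in> carrier R" "r \<noteq> \<zero>\<^bsub>R\<^esub>" "r \<odot>\<^bsub>P\<^esub> x \<in> ?C" using tors[OF x] by blast
    then obtain a b where ab: "a \<in> A" "b \<in> B" "r \<odot>\<^bsub>P\<^esub> x = a \<oplus>\<^bsub>P\<^esub> b" by (auto simp: set_add_def')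
    \<comment> \<open>Applying \<open>e\<close> to \<open>r x = a + b\<close> leaves
      \<open>a\<close>, so \<open>e x\<close> has a nonzero multiple in \<open>A\<close>.\<close>
    have "r \<odot>\<^bsub>P\<^esub> e x = a" using mod_homD(3)[OF e(1) r(1) x] e(2)[OF ab(1,2)] ab(3) by simp
    then show ?thesis using k\<pi>0[OF mod_homD(1)[OF e(1) x]] r ab by blast
  qed

  show ?thesis
    unfolding projective_def
  proof (intro conjI allI impI ballI Q)
    fix N L :: "('r, ('r, 'm set) univ) module" and g f
    assume N: "left_module R N" and L: "left_module R L" and g: "g \<in> mod_hom R N L"
      and f: "f \<in> mod_hom R ?Q L" and g_surj: "g ` carrier N = carrier L"
    note fk = mod_hom_comp[OF k\<pi> f]
    \<comment> \<open>The test modules live in a type built from that of \<open>M/t(M)\<close>,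
      whereas projectivity of \<open>P\<close> tests a type built from that of \<open>P\<close>;
      \<open>projective_lift\<close> bridges the two.\<close>
    obtain h where h: "h \<in> mod_hom R P N" "\<And>x. x \<in> carrier P \<Longrightarrow> g (h x) = f (?k (\<pi> x))"
      using projective_lift[OF P(1) N L g g_surj fk] by blast
    note w = mod_hom_diff[OF PM PM mod_hom_id e(1)]
    \<comment> \<open>By \<open>fix_ker\<close>, \<open>1 - e\<close> vanishes on the kernel of
      \<open>P \<rightarrow> M/t(M)\<close>, so \<open>h\<close> after \<open>1 - e\<close> factors
      through \<open>M/t(M)\<close>.\<close>
    have "h (x \<ominus>\<^bsub>P\<^esub> e x) = \<zero>\<^bsub>N\<^esub>" if "x \<in> carrier P" "?k (\<pi> x) = \<zero>\<^bsub>?Q\<^esub>" for x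
      using fix_ker[OF that] that(1) mod_hom_zero[OF PM N h(1)] P.M.minus_eq_zero_iff[of x x] by simp
    from mod_hom_factor[OF PM Q N k\<pi> k\<pi>_surj mod_hom_comp[OF w h(1)] this]
    obtain h' where h': "h' \<in> mod_hom R ?Q N"
      "\<And>x. x \<in> carrier P \<Longrightarrow> h' (?k (\<pi> x)) = h (x \<ominus>\<^bsub>P\<^esub> e x)" by blast
    have "g (h' y) = f y" if y: "y \<in> carrier ?Q" for y
    proof -
      obtain x where x: "x \<in> carrier P" "y = ?k (\<pi> x)" using y unfolding k\<pi>_surj[symmetric] by auto
      interpret L: left_module R L by (rule L)
      note ex = mod_homD(1)[OF e(1) x(1)]
      have "g (h' y) = f (?k (\<pi> (x \<ominus>\<^bsub>P\<^esub> e x)))"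
        using h'(2)[OF x(1)] h(2)[of "x \<ominus>\<^bsub>P\<^esub> e x"] x ex by simp
      \<comment> \<open>By \<open>e_ker\<close> the second term is zero, so precomposition with
        \<open>1 - e\<close> has not changed the map being lifted.\<close>
      also have "\<dots> = f (?k (\<pi> x)) \<ominus>\<^bsub>L\<^esub> f (?k (\<pi> (e x)))"
        by (rule mod_hom_minus[OF PM L fk x(1) ex])
      also have "\<dots> = f y"
        using e_ker[OF x(1)] mod_hom_zero[OF Q L f] mod_homD(1)[OF f y] x(2) by (simp add: a_minus_def)
      finally show ?thesis .
    qed
    then show "\<exists>h\<in>mod_hom R ?Q N. \<forall>x\<in>carrier ?Q. g (h x) = f x"
      by (intro bexI[OF _ h'(1)] ballI)
  qed
qed

end
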